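(* Let $X$ be a Banach space with a $1$-unconditional basis $(e_n)_{n\in\mathbb{N}}$. If $X$ is considered as a Banach lattice with the coordinatewise order, then $X$ has the isometric lattice-lifting property.
   Context: All Banach spaces are real; $B_E$ is the closed unit ball of $E$. A lattice homomorphism between Banach lattices is a bounded linear operator preserving lattice operations. A sublattice means a closed vector sublattice. A Schauder basis $(e_n)_{n\in\mathbb{N}}$ of a Banach space $E$ is $1$-unconditional if for every $n\in\mathbb{N}$ and $a_1,\dots,a_n,b_1,\dots,b_n\in\mathbb{R}$ with $|a_i|\le|b_i|$ for all $i$, one has $\|\sum_{i=1}^n a_ie_i\|\le\|\sum_{i=1}^n b_ie_i\|$. Then $E$ is a Banach lattice with the coordinatewise order: $x\le y$ iff $e_n^*(x)\le e_n^*(y)$ for all $n\in\mathbb{N}$, where $(e_n^* )_{n\in\mathbb{N}}$ are the biorthogonal functionals. Free Banach lattice: for a Banach space $E$ and a positively homogeneous function $f:E^*\to\mathbb{R}$ (i.e. $f(\lambda x^* )=\lambda f(x^* )$ for $\lambda>0$), put $\|f\|_{FBL[E]}:=\sup\{\sum_{i=1}^n|f(x_i^* )|: n\in\mathbb{N},\ x_1^*,\dots,x_n^*\in E^*,\ \sup_{x\in B_E}\sum_{i=1}^n|x_i^*(x)|\le 1\}\in[0,\infty]$. Let $H_0[E]$ be the Banach lattice of all positively homogeneous $f$ with $\|f\|_{FBL[E]}<\infty$, with this norm and the pointwise order. $FBL[E]$ is the (closed) sublattice of $H_0[E]$ generated by $\{\delta_E(x):x\in E\}$, where $\delta_E(x)(x^*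 ):=x^*(x)$. The map $\delta_E:E\to FBL[E]$ is a linear isometry, and for every Banach lattice $X$ and bounded linear $T:E\to X$ there is a unique lattice homomorphism $\hat T:FBL[E]\to X$ with $\hat T\circ\delta_E=T$; moreover $\|\hat T\|=\|T\|$. For a Banach lattice $X$, $\beta_X:FBL[X]\to X$ is the unique lattice homomorphism with $\beta_X\circ\delta_X=id_X$. A Banach lattice $X$ has the isometric lattice-lifting property if there is a lattice homomorphism $T:X\to FBL[X]$ with $\beta_X\circ T=id_X$ and $\|T\|=1$. *)

theory Defs
  imports "HOL-Analysis.Analysis"
begin

section \<open>Banach lattices and lattice homomorphisms\<close>

text \<open>The order is an explicit parameter, because the order of interest on a Banach space with a
  basis depends on the basis and is not attached to the type.\<close>

definition is_sup :: "('a \<Rightarrow> 'a \<Rightarrow> bool) \<Rightarrow> 'a \<Rightarrow> 'a \<Rightarrow> 'a \<Rightarrow> bool" where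
  "is_sup le x y s \<longleftrightarrow> le x s \<and> le y s \<and> (\<forall>z. le x z \<longrightarrow> le y z \<longrightarrow> le s z)"

definition is_inf :: "('a \<Rightarrow> 'a \<Rightarrow> bool) \<Rightarrow> 'a \<Rightarrow> 'a \<Rightarrow> 'a \<Rightarrow> bool" where
  "is_inf le x y s \<longleftrightarrow> le s x \<and> le s y \<and> (\<forall>z. le z x \<longrightarrow> le z y \<longrightarrow> le z s)"

text \<open>In the last axiom, \<open>u\<close> and \<open>v\<close> are the moduli of \<open>x\<close> and \<open>y\<close>.\<close>

locale banach_lattice =
  fixes le :: "'a::banach \<Rightarrow> 'a \<Rightarrow> bool"
  assumes refl: "le x x"
    and trans: "le x y \<Longrightarrow> le y z \<Longrightarrow> le x z"
    and antisym: "le x y \<Longrightarrow> le y x \<Longrightarrow> x = y"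
    and add_mono: "le x y \<Longrightarrow> le (x + z) (y + z)"
    and scale_mono: "0 \<le> r \<Longrightarrow> le x y \<Longrightarrow> le (r *\<^sub>R x) (r *\<^sub>R y)"
    and ex_sup: "\<exists>s. is_sup le x y s"
    and ex_inf: "\<exists>s. is_inf le x y s"
    and norm_mono: "is_sup le x (- x) u \<Longrightarrow> is_sup le y (- y) v \<Longrightarrow> le u v \<Longrightarrow> norm x \<le> norm y"

definition lattice_hom ::
  "('a::real_normed_vector \<Rightarrow> 'a \<Rightarrow> bool) \<Rightarrow> ('b::real_normed_vector \<Rightarrow> 'b \<Rightarrow> bool) \<Rightarrow> ('a \<Rightarrow> 'b) \<Rightarrow> bool"
  where
  "lattice_hom le1 le2 T \<longleftrightarrow> bounded_linear T \<and>
     (\<forall>x y s. is_sup le1 x y s \<longrightarrow> is_sup le2 (T x) (T y) (T s)) \<and>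
     (\<forall>x y s. is_inf le1 x y s \<longrightarrow> is_inf le2 (T x) (T y) (T s))"


section \<open>Unconditional bases\<close>

definition schauder_basis :: "(nat \<Rightarrow> 'a::banach) \<Rightarrow> bool" where
  "schauder_basis e \<longleftrightarrow> (\<forall>x. \<exists>!a. (\<lambda>n. a n *\<^sub>R e n) sums x)"

text \<open>\<open>basis_coord e n\<close> is the biorthogonal functional \<open>e\<^sub>n\<^sup>*\<close>; the \<open>THE\<close> is well defined for a Schauder
  basis.\<close>

definition basis_coord :: "(nat \<Rightarrow> 'a::banach) \<Rightarrow> nat \<Rightarrow> 'a \<Rightarrow> real" where
  "basis_coord e n x = (THE a. (\<lambda>n. a n *\<^sub>R e n) sums x) n"

definition one_unconditional_basis :: "(nat \<Rightarrow> 'a::banach) \<Rightarrow> bool" where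
  "one_unconditional_basis e \<longleftrightarrow> schauder_basis e \<and>
     (\<forall>n a b. (\<forall>i<n. \<bar>a i\<bar> \<le> \<bar>b i\<bar>) \<longrightarrow>
        norm (\<Sum>i<n. a i *\<^sub>R e i) \<le> norm (\<Sum>i<n. b i *\<^sub>R e i))"

definition coord_le :: "(nat \<Rightarrow> 'a::banach) \<Rightarrow> 'a \<Rightarrow> 'a \<Rightarrow> bool" where
  "coord_le e x y \<longleftrightarrow> (\<forall>n. basis_coord e n x \<le> basis_coord e n y)"


section \<open>The Banach lattice of positively homogeneous functions of finite norm\<close>

text \<open>\<open>weakly_1_summing n \<phi>\<close> says that \<open>sup\<^bsub>\<parallel>x\<parallel> \<le> 1\<^esub> \<Sum>\<^bsub>i<n\<^esub> \<bar>\<phi> i x\<bar> \<le> 1\<close>.\<close>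

definition weakly_1_summing :: "nat \<Rightarrow> (nat \<Rightarrow> ('a::banach \<Rightarrow>\<^sub>L real)) \<Rightarrow> bool" where
  "weakly_1_summing n \<phi> \<longleftrightarrow> (\<forall>x\<in>cball 0 1. (\<Sum>i<n. \<bar>blinfun_apply (\<phi> i) x\<bar>) \<le> 1)"

definition fbl_norm :: "(('a::banach \<Rightarrow>\<^sub>L real) \<Rightarrow> real) \<Rightarrow> ennreal" where
  "fbl_norm f = (SUP (n, \<phi>) \<in> {(n, \<phi>). weakly_1_summing n \<phi>}. ennreal (\<Sum>i<n. \<bar>f (\<phi> i)\<bar>))"

definition pos_homogeneous :: "('v::real_vector \<Rightarrow> real) \<Rightarrow> bool" where
  "pos_homogeneous f \<longleftrightarrow> (\<forall>c>0. \<forall>v. f (c *\<^sub>R v) = c * f v)"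

lemma fbl_norm_le_iff:
  assumes "C \<ge> 0"
  shows "fbl_norm f \<le> ennreal C \<longleftrightarrow>
    (\<forall>n \<phi>. weakly_1_summing n \<phi> \<longrightarrow> (\<Sum>i<n. \<bar>f (\<phi> i)\<bar>) \<le> C)"
  using assms by (auto simp: fbl_norm_def SUP_le_iff)

lemma fbl_norm_finite_iff:
  "fbl_norm f < top \<longleftrightarrow> (\<exists>C. \<forall>n \<phi>. weakly_1_summing n \<phi> \<longrightarrow> (\<Sum>i<n. \<bar>f (\<phi> i)\<bar>) \<le> C)"
proof
  assume "fbl_norm f < top"
  then obtain C where "C \<ge> 0" "fbl_norm f = ennreal C"
    by (cases "fbl_norm f") auto
  then show "\<exists>C. \<forall>n \<phi>. weakly_1_summing n \<phi> \<longrightarrow> (\<Sum>i<n. \<bar>f (\<phi> i)\<bar>) \<le> C"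
    using fbl_norm_le_iff[of C f] by auto
next
  assume "\<exists>C. \<forall>n \<phi>. weakly_1_summing n \<phi> \<longrightarrow> (\<Sum>i<n. \<bar>f (\<phi> i)\<bar>) \<le> C"
  then obtain C where "\<forall>n \<phi>. weakly_1_summing n \<phi> \<longrightarrow> (\<Sum>i<n. \<bar>f (\<phi> i)\<bar>) \<le> C"
    by blast
  then have "fbl_norm f \<le> ennreal (max C 0)"
    by (subst fbl_norm_le_iff) (auto simp: le_max_iff_disj)
  then show "fbl_norm f < top"
    by (simp add: le_less_trans)
qed

text \<open>The type variable is the space \<open>E\<close>, so the elements are functions on its dual.\<close>

typedef (overloaded) 'a H0 =
  "{f :: ('a::banach \<Rightarrow>\<^sub>L real) \<Rightarrow> real. pos_homogeneous f \<and> fbl_norm f < top}"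
  morphisms H0_fun Abs_H0
  by (rule exI[of _ "\<lambda>_. 0"]) (auto simp: pos_homogeneous_def fbl_norm_finite_iff)

setup_lifting type_definition_H0

lemma H0_fun_bound:
  "\<exists>C. \<forall>n \<phi>. weakly_1_summing n \<phi> \<longrightarrow> (\<Sum>i<n. \<bar>H0_fun f (\<phi> i)\<bar>) \<le> C"
  using H0_fun[of f] by (simp add: fbl_norm_finite_iff)

lemma H0_fun_scale: "c > 0 \<Longrightarrow> H0_fun f (c *\<^sub>R v) = c * H0_fun f v"
  using H0_fun[of f] by (simp add: pos_homogeneous_def)

lemma H0_fun_0: "H0_fun f 0 = 0"
  using H0_fun_scale[of 2 f 0] by simp

lemma sum_abs_dominated:
  assumes "\<And>i. i < n \<Longrightarrow> \<bar>h (\<phi> i)\<bar> \<le> \<bar>f (\<phi> i)\<bar> + \<bar>g (\<phi> i)\<bar>"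
    and "(\<Sum>i<n. \<bar>f (\<phi> i)\<bar>) \<le> C" and "(\<Sum>i<n. \<bar>g (\<phi> i)\<bar>) \<le> D"
  shows "(\<Sum>i<n. \<bar>h (\<phi> i)\<bar>) \<le> C + (D::real)"
proof -
  have "(\<Sum>i<n. \<bar>h (\<phi> i)\<bar>) \<le> (\<Sum>i<n. \<bar>f (\<phi> i)\<bar> + \<bar>g (\<phi> i)\<bar>)"
    using assms(1) by (intro sum_mono) auto
  then show ?thesis
    using assms(2,3) by (simp add: sum.distrib)
qed

lemma fbl_norm_finite_dominated:
  assumes "fbl_norm f < top" "fbl_norm g < top" and "\<And>v. \<bar>h v\<bar> \<le> \<bar>f v\<bar> + \<bar>g v\<bar>"
  shows "fbl_norm h < top"
proof -
  obtain C where C: "\<forall>n \<phi>. weakly_1_summing n \<phi> \<longrightarrow> (\<Sum>i<n. \<bar>f (\<phi> i)\<bar>) \<le> C"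
    using assms(1) unfolding fbl_norm_finite_iff by blast
  obtain D where D: "\<forall>n \<phi>. weakly_1_summing n \<phi> \<longrightarrow> (\<Sum>i<n. \<bar>g (\<phi> i)\<bar>) \<le> D"
    using assms(2) unfolding fbl_norm_finite_iff by blast
  show ?thesis
    unfolding fbl_norm_finite_iff
    using C D assms(3) sum_abs_dominated[of _ h _ f g] by blast
qed

lemma fbl_norm_finite_scale:
  assumes "fbl_norm f < top"
  shows "fbl_norm (\<lambda>v. r * f v) < top"
proof -
  obtain C where C: "\<forall>n \<phi>. weakly_1_summing n \<phi> \<longrightarrow> (\<Sum>i<n. \<bar>f (\<phi> i)\<bar>) \<le> C"
    using assms unfolding fbl_norm_finite_iff by blast
  have "\<forall>n \<phi>. weakly_1_summing n \<phi> \<longrightarrow> (\<Sum>i<n. \<bar>r * f (\<phi> i)\<bar>) \<le> \<bar>r\<bar> * C"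
    using C by (auto simp: abs_mult sum_distrib_left[symmetric] intro!: mult_left_mono)
  then show ?thesis
    unfolding fbl_norm_finite_iff by blast
qed

instantiation H0 :: (banach) "{zero, plus, minus, uminus, scaleR, lattice}"
begin

lift_definition zero_H0 :: "'a H0" is "\<lambda>_. 0"
  by (auto simp: pos_homogeneous_def fbl_norm_finite_iff)

lift_definition plus_H0 :: "'a H0 \<Rightarrow> 'a H0 \<Rightarrow> 'a H0" is "\<lambda>f g v. f v + g v"
  by (auto simp: pos_homogeneous_def distrib_left intro: fbl_norm_finite_dominated)

lift_definition minus_H0 :: "'a H0 \<Rightarrow> 'a H0 \<Rightarrow> 'a H0" is "\<lambda>f g v. f v - g v"
  by (auto simp: pos_homogeneous_def right_diff_distrib intro: fbl_norm_finite_dominated)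

lift_definition uminus_H0 :: "'a H0 \<Rightarrow> 'a H0" is "\<lambda>f v. - f v"
  by (auto simp: pos_homogeneous_def intro: fbl_norm_finite_dominated)

lift_definition scaleR_H0 :: "real \<Rightarrow> 'a H0 \<Rightarrow> 'a H0" is "\<lambda>r f v. r * f v"
  by (auto simp: pos_homogeneous_def fbl_norm_finite_scale[simplified])

lift_definition sup_H0 :: "'a H0 \<Rightarrow> 'a H0 \<Rightarrow> 'a H0" is "\<lambda>f g v. max (f v) (g v)"
  by (auto simp: pos_homogeneous_def max_mult_distrib_left intro: fbl_norm_finite_dominated)

lift_definition inf_H0 :: "'a H0 \<Rightarrow> 'a H0 \<Rightarrow> 'a H0" is "\<lambda>f g v. min (f v) (g v)"
  by (auto simp: pos_homogeneous_def min_mult_distrib_left intro: fbl_norm_finite_dominated)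

lift_definition less_eq_H0 :: "'a H0 \<Rightarrow> 'a H0 \<Rightarrow> bool" is "\<lambda>f g. \<forall>v. f v \<le> g v" .

definition less_H0 :: "'a H0 \<Rightarrow> 'a H0 \<Rightarrow> bool" where "less_H0 f g \<longleftrightarrow> f \<le> g \<and> \<not> g \<le> f"

instance
proof
  fix f g h :: "'a H0"
  show "f < g \<longleftrightarrow> f \<le> g \<and> \<not> g \<le> f"
    by (rule less_H0_def)
  show "f \<le> f" "inf f g \<le> f" "inf f g \<le> g" "f \<le> sup f g" "g \<le> sup f g"
    by (transfer, simp)+
  show "f \<le> g \<Longrightarrow> g \<le> h \<Longrightarrow> f \<le> h"
    by transfer (blast intro: order_trans)
  show "f \<le> g \<Longrightarrow> g \<le> f \<Longrightarrow> f = g"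
    by transfer (rule ext, blast intro: order_antisym)
  show "f \<le> g \<Longrightarrow> f \<le> h \<Longrightarrow> f \<le> inf g h" "g \<le> f \<Longrightarrow> h \<le> f \<Longrightarrow> sup g h \<le> f"
    by (transfer, simp)+
qed

end

lemma H0_eqI: "(\<And>v. H0_fun f v = H0_fun g v) \<Longrightarrow> f = g"
  by (metis H0_fun_inject ext)

lemmas H0_fun_simps [simp] =
  zero_H0.rep_eq plus_H0.rep_eq minus_H0.rep_eq uminus_H0.rep_eq scaleR_H0.rep_eq
  sup_H0.rep_eq inf_H0.rep_eq

definition H0_norm :: "'a::banach H0 \<Rightarrow> real" where
  "H0_norm f = enn2real (fbl_norm (H0_fun f))"

lemma ennreal_H0_norm: "ennreal (H0_norm f) = fbl_norm (H0_fun f)"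
  using H0_fun[of f] by (simp add: H0_norm_def)

lemma H0_norm_ge:
  "weakly_1_summing n \<phi> \<Longrightarrow> (\<Sum>i<n. \<bar>H0_fun f (\<phi> i)\<bar>) \<le> H0_norm f"
proof -
  have "H0_norm f \<ge> 0"
    by (simp add: H0_norm_def)
  from fbl_norm_le_iff[OF this, of "H0_fun f"]
  have "\<forall>n \<phi>. weakly_1_summing n \<phi> \<longrightarrow> (\<Sum>i<n. \<bar>H0_fun f (\<phi> i)\<bar>) \<le> H0_norm f"
    unfolding ennreal_H0_norm by blast
  then show "weakly_1_summing n \<phi> \<Longrightarrow> (\<Sum>i<n. \<bar>H0_fun f (\<phi> i)\<bar>) \<le> H0_norm f"
    by blast
qed

lemma H0_norm_le:
  assumes "\<And>n \<phi>. weakly_1_summing n \<phi> \<Longrightarrow> (\<Sum>i<n. \<bar>H0_fun f (\<phi> i)\<bar>) \<le> C"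
  shows "H0_norm f \<le> C"
proof -
  have C: "C \<ge> 0"
    using assms[of 0 "\<lambda>_. 0"] by (simp add: weakly_1_summing_def)
  then have "ennreal (H0_norm f) \<le> ennreal C"
    using assms by (simp add: ennreal_H0_norm fbl_norm_le_iff)
  then show ?thesis
    using C by simp
qed

lemma H0_norm_abs_le: "\<bar>H0_fun f v\<bar> \<le> H0_norm f * norm v"
proof (cases "v = 0")
  case False
  have "weakly_1_summing (Suc 0) (\<lambda>_. v /\<^sub>R norm v)"
    unfolding weakly_1_summing_def
  proof
    fix x :: 'a assume "x \<in> cball 0 1"
    then have "\<bar>blinfun_apply v x\<bar> \<le> norm v"
      using norm_blinfun[of v x] mult_left_mono[of "norm x" 1 "norm v"] by simp
    then show "(\<Sum>i<Suc 0. \<bar>blinfun_apply (v /\<^sub>R norm v) x\<bar>) \<le> 1"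
      using False by (simp add: blinfun.scaleR_left abs_mult divide_simps)
  qed
  from H0_norm_ge[OF this, of f] show ?thesis
    using False by (simp add: H0_fun_scale abs_mult divide_simps mult.commute)
qed (simp add: H0_fun_0)

instantiation H0 :: (banach) real_normed_vector
begin

definition norm_H0 :: "'a H0 \<Rightarrow> real" where "norm_H0 = H0_norm"

definition sgn_H0 :: "'a H0 \<Rightarrow> 'a H0" where "sgn_H0 f = f /\<^sub>R norm f"

definition dist_H0 :: "'a H0 \<Rightarrow> 'a H0 \<Rightarrow> real" where "dist_H0 f g = norm (f - g)"

definition uniformity_H0 :: "('a H0 \<times> 'a H0) filter" where
  "uniformity_H0 = (INF e\<in>{0<..}. principal {(x, y). dist x y < e})"

definition open_H0 :: "'a H0 set \<Rightarrow> bool" where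
  "open_H0 U \<longleftrightarrow> (\<forall>x\<in>U. eventually (\<lambda>(x', y). x' = x \<longrightarrow> y \<in> U) uniformity)"

instance
proof
  fix f g h :: "'a H0" and a b :: real
  show "f + g + h = f + (g + h)" "f + g = g + f" "0 + f = f" "- f + f = 0" "f - g = f + - g"
    "a *\<^sub>R (f + g) = a *\<^sub>R f + a *\<^sub>R g" "(a + b) *\<^sub>R f = a *\<^sub>R f + b *\<^sub>R f"
    "a *\<^sub>R b *\<^sub>R f = (a * b) *\<^sub>R f" "1 *\<^sub>R f = f"
    by (auto intro!: H0_eqI simp: algebra_simps)
  show "sgn f = f /\<^sub>R norm f" "dist f g = norm (f - g)"
    by (simp_all add: sgn_H0_def dist_H0_def)
  show "uniformity = (INF e\<in>{0<..}. principal {(x, y::'a H0). dist x y < e})"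
    by (rule uniformity_H0_def)
  show "open U \<longleftrightarrow> (\<forall>x\<in>U. eventually (\<lambda>(x', y). x' = x \<longrightarrow> y \<in> U) uniformity)" for U :: "'a H0 set"
    by (rule open_H0_def)
  note ge = H0_norm_ge[where 'a='a, folded norm_H0_def] and le = H0_norm_le[where 'a='a, folded norm_H0_def]
    and abs_le = H0_norm_abs_le[where 'a='a, folded norm_H0_def]
  show "norm f = 0 \<longleftrightarrow> f = 0"
  proof
    assume "norm f = 0"
    then have "H0_fun f v = 0" for v
      using abs_le[of f v] by simp
    then show "f = 0"
      by (intro H0_eqI) simp
  next
    assume "f = 0"
    then have "norm f \<le> 0"
      by (intro le) simp
    then show "norm f = 0"
      by (simp add: norm_H0_def H0_norm_def order_antisym)
  qed
  show "norm (f + g) \<le> norm f + norm g"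
  proof (rule le)
    fix n and \<phi> :: "nat \<Rightarrow> 'a \<Rightarrow>\<^sub>L real"
    assume "weakly_1_summing n \<phi>"
    then show "(\<Sum>i<n. \<bar>H0_fun (f + g) (\<phi> i)\<bar>) \<le> norm f + norm g"
      by (intro sum_abs_dominated[of _ _ _ "H0_fun f" "H0_fun g"] ge)
        (simp add: abs_triangle_ineq)
  qed
  have scale: "norm (c *\<^sub>R k) \<le> \<bar>c\<bar> * norm k" for c and k :: "'a H0"
  proof (rule le)
    fix n and \<phi> :: "nat \<Rightarrow> 'a \<Rightarrow>\<^sub>L real"
    assume "weakly_1_summing n \<phi>"
    from mult_left_mono[OF ge[OF this, of k], of "\<bar>c\<bar>"]
    show "(\<Sum>i<n. \<bar>H0_fun (c *\<^sub>R k) (\<phi> i)\<bar>) \<le> \<bar>c\<bar> * norm k"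
      by (simp add: abs_mult sum_distrib_left)
  qed
  show "norm (a *\<^sub>R f) = \<bar>a\<bar> * norm f"
  proof (cases "a = 0")
    case True
    have "norm (a *\<^sub>R f) \<ge> 0"
      by (simp add: norm_H0_def H0_norm_def)
    then show ?thesis
      using True scale[of a f] by simp
  next
    case False
    have "inverse a *\<^sub>R a *\<^sub>R f = f"
      using False by (intro H0_eqI) simp
    then have "norm f \<le> \<bar>inverse a\<bar> * norm (a *\<^sub>R f)"
      using scale[of "inverse a" "a *\<^sub>R f"] by (simp only:)
    then have "\<bar>a\<bar> * norm f \<le> \<bar>a\<bar> * (\<bar>inverse a\<bar> * norm (a *\<^sub>R f))"
      by (rule mult_left_mono) simp
    also have "\<dots> = norm (a *\<^sub>R f)"
      using False by (simp add: mult.assoc[symmetric] abs_mult[symmetric])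
    finally show ?thesis
      using scale[of a f] by (rule order_antisym[rotated])
  qed
qed

end

lemmas norm_H0_ge = H0_norm_ge[folded norm_H0_def]
lemmas norm_H0_le = H0_norm_le[folded norm_H0_def]
lemmas H0_fun_abs_le = H0_norm_abs_le[folded norm_H0_def]

instance H0 :: (banach) banach
proof
  fix F :: "nat \<Rightarrow> 'a H0"
  assume "Cauchy F"
  have "Cauchy (\<lambda>k. H0_fun (F k) v)" for v
  proof (rule CauchyI)
    fix r :: real assume r: "r > 0"
    define d where "d = r / (norm v + 1)"
    have pos: "norm v + 1 > 0"
      by (simp add: add_nonneg_pos)
    then have d: "d > 0"
      using r by (simp add: d_def)
    then obtain M where M: "\<And>m n. m \<ge> M \<Longrightarrow> n \<ge> M \<Longrightarrow> norm (F m - F n) < d"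
      using CauchyD[OF \<open>Cauchy F\<close>] by blast
    have "norm (H0_fun (F m) v - H0_fun (F n) v) < r" if "m \<ge> M" "n \<ge> M" for m n
    proof -
      have "\<bar>H0_fun (F m) v - H0_fun (F n) v\<bar> \<le> norm (F m - F n) * norm v"
        using H0_fun_abs_le[of "F m - F n" v] by simp
      also have "\<dots> \<le> d * norm v"
        using M[OF that] by (intro mult_right_mono) auto
      also have "\<dots> < d * (norm v + 1)"
        using d by simp
      also have "\<dots> = r"
        using pos by (simp add: d_def)
      finally show ?thesis by simp
    qed
    then show "\<exists>M. \<forall>m\<ge>M. \<forall>n\<ge>M. norm (H0_fun (F m) v - H0_fun (F n) v) < r"
      by blast
  qed
  then have "\<exists>l. (\<lambda>k. H0_fun (F k) v) \<longlonglongrightarrow> l" for v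
    using Cauchy_convergent convergent_def by blast
  then obtain l where l: "\<And>v. (\<lambda>k. H0_fun (F k) v) \<longlonglongrightarrow> l v"
    by metis
  have limit_le: "(\<Sum>i<n. \<bar>H0_fun (F m) (\<phi> i) - l (\<phi> i)\<bar>) \<le> r"
    if M: "\<forall>m\<ge>M. \<forall>n\<ge>M. norm (F m - F n) < r" and "m \<ge> M" and adm: "weakly_1_summing n \<phi>"
    for M m n r and \<phi> :: "nat \<Rightarrow> 'a \<Rightarrow>\<^sub>L real"
  proof (rule tendsto_upperbound)
    show "(\<lambda>k. \<Sum>i<n. \<bar>H0_fun (F m) (\<phi> i) - H0_fun (F k) (\<phi> i)\<bar>)
        \<longlonglongrightarrow> (\<Sum>i<n. \<bar>H0_fun (F m) (\<phi> i) - l (\<phi> i)\<bar>)"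
      by (intro tendsto_intros l)
    have "(\<Sum>i<n. \<bar>H0_fun (F m) (\<phi> i) - H0_fun (F k) (\<phi> i)\<bar>) \<le> r" if "k \<ge> M" for k
      using norm_H0_ge[OF adm, of "F m - F k"] M \<open>m \<ge> M\<close> that by fastforce
    then show "\<forall>\<^sub>F k in sequentially.
        (\<Sum>i<n. \<bar>H0_fun (F m) (\<phi> i) - H0_fun (F k) (\<phi> i)\<bar>) \<le> r"
      by (auto simp: eventually_sequentially)
  qed simp
  obtain M where M: "\<forall>m\<ge>M. \<forall>n\<ge>M. norm (F m - F n) < 1"
    using CauchyD[OF \<open>Cauchy F\<close>, of 1] by auto
  have diff: "fbl_norm (\<lambda>v. H0_fun (F M) v - l v) < top"
    unfolding fbl_norm_finite_iff using limit_le[OF M order_refl] by blast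
  have "fbl_norm l < top"
    by (rule fbl_norm_finite_dominated[OF diff, of "H0_fun (F M)"])
      (use H0_fun[of "F M"] in auto)
  moreover have "pos_homogeneous l"
    unfolding pos_homogeneous_def
  proof (intro allI impI)
    fix c :: real and v assume "c > 0"
    then have "(\<lambda>k. H0_fun (F k) (c *\<^sub>R v)) \<longlonglongrightarrow> c * l v"
      by (simp add: H0_fun_scale l tendsto_mult_left)
    then show "l (c *\<^sub>R v) = c * l v"
      using l LIMSEQ_unique by blast
  qed
  ultimately have L: "H0_fun (Abs_H0 l) = l"
    by (simp add: Abs_H0_inverse)
  have "F \<longlonglongrightarrow> Abs_H0 l"
  proof (rule LIMSEQ_I)
    fix r :: real assume "r > 0"
    then obtain M where M: "\<forall>m\<ge>M. \<forall>n\<ge>M. norm (F m - F n) < r / 2"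
      using CauchyD[OF \<open>Cauchy F\<close>, of "r / 2"] by auto
    have "norm (F m - Abs_H0 l) \<le> r / 2" if "m \<ge> M" for m
      by (rule norm_H0_le) (use limit_le[OF M that] L in simp)
    then show "\<exists>M. \<forall>m\<ge>M. norm (F m - Abs_H0 l) < r"
      using \<open>r > 0\<close> by (intro exI[of _ M]) fastforce
  qed
  then show "convergent F"
    by (auto simp: convergent_def)
qed


section \<open>The free Banach lattice\<close>

lift_definition H0_delta :: "'a::banach \<Rightarrow> 'a H0" is "\<lambda>x v. blinfun_apply v x"
proof (intro CollectI conjI)
  fix x :: 'a
  show "pos_homogeneous (\<lambda>v. blinfun_apply v x)"
    by (simp add: pos_homogeneous_def blinfun.scaleR_left)
  have "(\<Sum>i<n. \<bar>blinfun_apply (\<phi> i) x\<bar>) \<le> norm x"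
    if "weakly_1_summing n \<phi>" for n and \<phi> :: "nat \<Rightarrow> 'a \<Rightarrow>\<^sub>L real"
  proof (cases "x = 0")
    case False
    have "(\<Sum>i<n. \<bar>blinfun_apply (\<phi> i) (x /\<^sub>R norm x)\<bar>) \<le> 1"
      using that False by (auto simp: weakly_1_summing_def)
    then have "(\<Sum>i<n. \<bar>blinfun_apply (\<phi> i) x\<bar>) / norm x \<le> 1"
      by (simp add: blinfun.scaleR_right abs_mult sum_distrib_left divide_inverse_commute)
    then show ?thesis
      using False by (simp add: divide_le_eq)
  qed simp
  then show "fbl_norm (\<lambda>v. blinfun_apply v x) < top"
    unfolding fbl_norm_finite_iff by blast
qed

definition closed_sublattice :: "'b::{real_normed_vector, lattice} set \<Rightarrow> bool" where
  "closed_sublattice S \<longleftrightarrow> subspace S \<and> closed S \<and> (\<forall>f\<in>S. \<forall>g\<in>S. sup f g \<in> S \<and> inf f g \<in> S)"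

lemma closed_sublattice_hull: "closed_sublattice (closed_sublattice hull A)"
proof (rule hull_in)
  fix F :: "'a set set" assume "Ball F closed_sublattice"
  then have F: "subspace S" "closed S" "\<And>f g. f \<in> S \<Longrightarrow> g \<in> S \<Longrightarrow> sup f g \<in> S \<and> inf f g \<in> S" if "S \<in> F" for S
    using that unfolding closed_sublattice_def by blast+
  have "subspace (\<Inter>F)"
    using F(1) by (rule subspace_Inter[OF ballI])
  moreover have "closed (\<Inter>F)"
    using F(2) by (rule closed_Inter[OF ballI])
  ultimately show "closed_sublattice (\<Inter>F)"
    using F(3) unfolding closed_sublattice_def by blast
qed

typedef (overloaded) 'a FBL = "closed_sublattice hull (range (H0_delta :: 'a::banach \<Rightarrow> 'a H0))"
  morphisms FBL_H0 Abs_FBL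
  by (rule exI[of _ "H0_delta 0"]) (simp add: hull_inc)

setup_lifting type_definition_FBL

lemma FBL_H0_closed:
  defines "S \<equiv> closed_sublattice hull (range (H0_delta :: 'a::banach \<Rightarrow> 'a H0))"
  shows "0 \<in> S" "f \<in> S \<Longrightarrow> g \<in> S \<Longrightarrow> f + g \<in> S" "f \<in> S \<Longrightarrow> g \<in> S \<Longrightarrow> f - g \<in> S"
    "f \<in> S \<Longrightarrow> - f \<in> S" "f \<in> S \<Longrightarrow> r *\<^sub>R f \<in> S" "f \<in> S \<Longrightarrow> g \<in> S \<Longrightarrow> sup f g \<in> S"
    "f \<in> S \<Longrightarrow> g \<in> S \<Longrightarrow> inf f g \<in> S" "closed S"
proof -
  have S: "subspace S" "closed S" "\<And>f g. f \<in> S \<Longrightarrow> g \<in> S \<Longrightarrow> sup f g \<in> S \<and> inf f g \<in> S"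
    using closed_sublattice_hull[of "range (H0_delta :: 'a \<Rightarrow> 'a H0)"]
    unfolding S_def closed_sublattice_def by blast+
  show "0 \<in> S" "f \<in> S \<Longrightarrow> g \<in> S \<Longrightarrow> f + g \<in> S" "f \<in> S \<Longrightarrow> g \<in> S \<Longrightarrow> f - g \<in> S"
    "f \<in> S \<Longrightarrow> - f \<in> S" "f \<in> S \<Longrightarrow> r *\<^sub>R f \<in> S"
    using S(1) by (simp_all add: subspace_0 subspace_add subspace_diff subspace_neg subspace_scale)
  show "f \<in> S \<Longrightarrow> g \<in> S \<Longrightarrow> sup f g \<in> S" "f \<in> S \<Longrightarrow> g \<in> S \<Longrightarrow> inf f g \<in> S" "closed S"
    using S(2,3) by auto
qed

instantiation FBL :: (banach) "{zero, plus, minus, uminus, scaleR, lattice}"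
begin

lift_definition zero_FBL :: "'a FBL" is 0 by (rule FBL_H0_closed)
lift_definition plus_FBL :: "'a FBL \<Rightarrow> 'a FBL \<Rightarrow> 'a FBL" is "(+)" by (rule FBL_H0_closed)
lift_definition minus_FBL :: "'a FBL \<Rightarrow> 'a FBL \<Rightarrow> 'a FBL" is "(-)" by (rule FBL_H0_closed)
lift_definition uminus_FBL :: "'a FBL \<Rightarrow> 'a FBL" is uminus by (rule FBL_H0_closed)
lift_definition scaleR_FBL :: "real \<Rightarrow> 'a FBL \<Rightarrow> 'a FBL" is scaleR by (rule FBL_H0_closed)
lift_definition sup_FBL :: "'a FBL \<Rightarrow> 'a FBL \<Rightarrow> 'a FBL" is sup by (rule FBL_H0_closed)
lift_definition inf_FBL :: "'a FBL \<Rightarrow> 'a FBL \<Rightarrow> 'a FBL" is inf by (rule FBL_H0_closed)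
lift_definition less_eq_FBL :: "'a FBL \<Rightarrow> 'a FBL \<Rightarrow> bool" is "(\<le>)" .
lift_definition less_FBL :: "'a FBL \<Rightarrow> 'a FBL \<Rightarrow> bool" is "(<)" .

instance
proof
  fix f g h :: "'a FBL"
  show "f < g \<longleftrightarrow> f \<le> g \<and> \<not> g \<le> f" "f \<le> f" "inf f g \<le> f" "inf f g \<le> g" "f \<le> sup f g" "g \<le> sup f g"
    by (transfer, simp add: less_le_not_le)+
  show "f \<le> g \<Longrightarrow> g \<le> h \<Longrightarrow> f \<le> h"
    by transfer (rule order_trans)
  show "f \<le> g \<Longrightarrow> g \<le> f \<Longrightarrow> f = g"
    by transfer (rule order_antisym)
  show "f \<le> g \<Longrightarrow> f \<le> h \<Longrightarrow> f \<le> inf g h" "g \<le> f \<Longrightarrow> h \<le> f \<Longrightarrow> sup g h \<le> f"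
    by (transfer, simp)+
qed

end

instantiation FBL :: (banach) real_normed_vector
begin

lift_definition norm_FBL :: "'a FBL \<Rightarrow> real" is norm .

definition sgn_FBL :: "'a FBL \<Rightarrow> 'a FBL" where "sgn_FBL f = f /\<^sub>R norm f"

definition dist_FBL :: "'a FBL \<Rightarrow> 'a FBL \<Rightarrow> real" where "dist_FBL f g = norm (f - g)"

definition uniformity_FBL :: "('a FBL \<times> 'a FBL) filter" where
  "uniformity_FBL = (INF e\<in>{0<..}. principal {(x, y). dist x y < e})"

definition open_FBL :: "'a FBL set \<Rightarrow> bool" where
  "open_FBL U \<longleftrightarrow> (\<forall>x\<in>U. eventually (\<lambda>(x', y). x' = x \<longrightarrow> y \<in> U) uniformity)"

instance
proof
  fix f g h :: "'a FBL" and a b :: real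
  show "f + g + h = f + (g + h)" "f + g = g + f" "0 + f = f" "- f + f = 0" "f - g = f + - g"
    "a *\<^sub>R (f + g) = a *\<^sub>R f + a *\<^sub>R g" "(a + b) *\<^sub>R f = a *\<^sub>R f + b *\<^sub>R f"
    "a *\<^sub>R b *\<^sub>R f = (a * b) *\<^sub>R f" "1 *\<^sub>R f = f"
    by (transfer, simp add: algebra_simps)+
  show "sgn f = f /\<^sub>R norm f" "dist f g = norm (f - g)"
    by (simp_all add: sgn_FBL_def dist_FBL_def)
  show "uniformity = (INF e\<in>{0<..}. principal {(x, y::'a FBL). dist x y < e})"
    by (rule uniformity_FBL_def)
  show "open U \<longleftrightarrow> (\<forall>x\<in>U. eventually (\<lambda>(x', y). x' = x \<longrightarrow> y \<in> U) uniformity)" for U :: "'a FBL set"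
    by (rule open_FBL_def)
  show "norm f = 0 \<longleftrightarrow> f = 0" "norm (f + g) \<le> norm f + norm g" "norm (a *\<^sub>R f) = \<bar>a\<bar> * norm f"
    by (transfer, simp add: norm_triangle_ineq)+
qed

end

instance FBL :: (banach) banach
proof
  fix F :: "nat \<Rightarrow> 'a FBL"
  assume "Cauchy F"
  have dist_eq: "dist f g = dist (FBL_H0 f) (FBL_H0 g)" for f g :: "'a FBL"
    by (simp add: dist_norm norm_FBL.rep_eq minus_FBL.rep_eq)
  have "Cauchy (\<lambda>k. FBL_H0 (F k))"
    using \<open>Cauchy F\<close> by (simp add: Cauchy_def dist_eq)
  then obtain l where l: "(\<lambda>k. FBL_H0 (F k)) \<longlonglongrightarrow> l"
    using Cauchy_convergent convergent_def by blast
  have "l \<in> closed_sublattice hull (range H0_delta)"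
    using closed_sequentially[OF FBL_H0_closed(8) _ l] FBL_H0 by blast
  then have "FBL_H0 (Abs_FBL l) = l"
    by (rule Abs_FBL_inverse)
  then have "F \<longlonglongrightarrow> Abs_FBL l"
    using l by (simp add: lim_sequentially dist_eq)
  then show "convergent F"
    by (auto simp: convergent_def)
qed

text \<open>Suprema and infima in \<open>FBL\<close> are the pointwise ones, and the pointwise order makes
  \<open>FBL\<close> a Banach lattice.\<close>

lemma is_sup_iff: "is_sup (\<le>) x y s \<longleftrightarrow> s = sup x (y::'b::lattice)"
  unfolding is_sup_def by (metis order_antisym sup.cobounded1 sup.cobounded2 sup_least)

lemma is_inf_iff: "is_inf (\<le>) x y s \<longleftrightarrow> s = inf x (y::'b::lattice)"
  unfolding is_inf_def by (metis order_antisym inf.cobounded1 inf.cobounded2 inf_greatest)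

lemma banach_lattice_FBL: "banach_lattice ((\<le>) :: 'a::banach FBL \<Rightarrow> 'a FBL \<Rightarrow> bool)"
proof
  fix x y z u v :: "'a FBL" and r :: real
  show "x \<le> x" "x \<le> y \<Longrightarrow> y \<le> z \<Longrightarrow> x \<le> z" "x \<le> y \<Longrightarrow> y \<le> x \<Longrightarrow> x = y"
    by auto
  show "x \<le> y \<Longrightarrow> x + z \<le> y + z"
    by transfer (simp add: less_eq_H0.rep_eq)
  show "0 \<le> r \<Longrightarrow> x \<le> y \<Longrightarrow> r *\<^sub>R x \<le> r *\<^sub>R y"
    by transfer (simp add: less_eq_H0.rep_eq mult_left_mono)
  show "\<exists>s. is_sup (\<le>) x y s" "\<exists>s. is_inf (\<le>) x y s"
    by (simp_all add: is_sup_iff is_inf_iff)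
  assume "is_sup (\<le>) x (- x) u" "is_sup (\<le>) y (- y) v" "u \<le> v"
  then have "sup x (- x) \<le> sup y (- y)"
    by (simp add: is_sup_iff)
  then show "norm x \<le> norm y"
  proof transfer
    fix f g :: "'a H0"
    assume "sup f (- f) \<le> sup g (- g)"
    then have M: "max (H0_fun f w) (- H0_fun f w) \<le> max (H0_fun g w) (- H0_fun g w)" for w
      unfolding less_eq_H0.rep_eq sup_H0.rep_eq uminus_H0.rep_eq by blast
    have *: "\<bar>H0_fun f w\<bar> \<le> \<bar>H0_fun g w\<bar>" for w
      using M[of w] by (simp add: abs_if max_def split: if_splits) 
    show "norm f \<le> norm g"
    proof (rule norm_H0_le)
      fix n and \<phi> :: "nat \<Rightarrow> 'a \<Rightarrow>\<^sub>L real"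
      assume "weakly_1_summing n \<phi>"
      then show "(\<Sum>i<n. \<bar>H0_fun f (\<phi> i)\<bar>) \<le> norm g"
        by (rule order_trans[OF sum_mono norm_H0_ge, rotated]) (rule *)
    qed
  qed
qed

lift_definition FBL_delta :: "'a::banach \<Rightarrow> 'a FBL" is H0_delta
  by (simp add: hull_inc)


section \<open>The isometric lattice-lifting property\<close>

text \<open>The map \<open>\<beta>\<^sub>X\<close>, whose existence and uniqueness is the universal property of \<open>FBL[X]\<close>
  applied to the identity of the Banach lattice \<open>X\<close>.\<close>

definition FBL_beta :: "('a::banach \<Rightarrow> 'a \<Rightarrow> bool) \<Rightarrow> 'a FBL \<Rightarrow> 'a" where
  "FBL_beta le = (THE \<beta>. lattice_hom (\<le>) le \<beta> \<and> \<beta> \<circ> FBL_delta = id)"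

definition isometric_lattice_lifting_property :: "('a::banach \<Rightarrow> 'a \<Rightarrow> bool) \<Rightarrow> bool" where
  "isometric_lattice_lifting_property le \<longleftrightarrow> banach_lattice le \<and>
     (\<exists>T :: 'a \<Rightarrow> 'a FBL. lattice_hom le (\<le>) T \<and> FBL_beta le \<circ> T = id \<and> onorm T = 1)"

end

theory Submission
  imports Defs
begin

text \<open>The evaluations at points of the dual are lattice homomorphisms on \<open>FBL[X]\<close>, and \<open>\<beta>\<close> is the map whose coordinates are the evaluations at the biorthogonal functionals:
  \<open>\<beta> f = \<Sum>\<^sub>n f(e\<^sub>n\<^sup>*) e\<^sub>n\<close>. A lifting is therefore obtained from pairwise disjoint positive elements
  \<open>f\<^sub>n\<close> of \<open>FBL[X]\<close> with \<open>f\<^sub>n(e\<^sub>k\<^sup>*) = \<delta>\<^sub>n\<^sub>k\<close>, by \<open>T x = \<Sum>\<^sub>n e\<^sub>n\<^sup>*(x) f\<^sub>n\<close>. With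
  \<open>h = \<Sum>\<^sub>m s\<^sub>m \<bar>\<delta>(e\<^sub>m)\<bar>\<close> for weights \<open>s\<^sub>m > 0\<close> making the series converge, the elements
  \<open>f\<^sub>n = (2 \<bar>\<delta>(e\<^sub>n)\<bar> - h / s\<^sub>n)\<^sup>+\<close> work: \<open>f\<^sub>n(v) \<noteq> 0\<close> means that the \<open>n\<close>-th summand exceeds half of
  \<open>h(v)\<close>, which happens for at most one \<open>n\<close>. Since moreover \<open>f\<^sub>n \<le> \<bar>\<delta>(e\<^sub>n)\<bar>\<close>, averaging over the
  vectors \<open>\<Sum>\<^sub>n \<plusminus> a\<^sub>n e\<^sub>n\<close>, whose norms all agree by unconditionality, gives
  \<open>\<parallel>\<Sum>\<^sub>n a\<^sub>n f\<^sub>n\<parallel> \<le> \<parallel>\<Sum>\<^sub>n a\<^sub>n e\<^sub>n\<parallel>\<close>.\<close>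

section \<open>Norming functionals on finite-dimensional subspaces\<close>

definition sublinear :: "('a::real_vector \<Rightarrow> real) \<Rightarrow> bool" where
  "sublinear p \<longleftrightarrow> (\<forall>x y. p (x + y) \<le> p x + p y) \<and> (\<forall>r\<ge>0. \<forall>x. p (r *\<^sub>R x) = r * p x)"

lemma sublinear_zero: "sublinear p \<Longrightarrow> p 0 = 0"
  unfolding sublinear_def by (metis mult_zero_left order_refl scaleR_zero_left)

lemma sublinear_minus_ge:
  assumes "sublinear p"
  shows "- p (- x) \<le> p x"
proof -
  have "p (x + - x) \<le> p x + p (- x)"
    using assms unfolding sublinear_def by blast
  then show ?thesis
    using sublinear_zero[OF assms] by simp
qed

lemma sublinear_norm: "sublinear (norm :: 'a::real_normed_vector \<Rightarrow> real)"
  by (simp add: sublinear_def norm_triangle_ineq)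

text \<open>The infimum in the proof plays the role of the Hahn-Banach extension step: \<open>q\<close> is odd at \<open>v\<close>.
  If \<open>p\<close> is odd at some \<open>w\<close>, then so is every sublinear \<open>q \<le> p\<close>, so the step can be iterated.\<close>

lemma sublinear_improve:
  assumes p: "sublinear p"
  obtains q where "sublinear q" "\<And>x. q x \<le> p x" "q (- v) \<le> - p v"
proof -
  define q where "q x = (INF t\<in>{0..}. p (x + t *\<^sub>R v) - t * p v)" for x
  have add: "p (x + y) \<le> p x + p y" and scale: "r \<ge> 0 \<Longrightarrow> p (r *\<^sub>R x) = r * p x" for x y r
    using p by (auto simp: sublinear_def)
  \<comment> \<open>Splitting t v as (x + t v) + (- x) bounds the expression below independently of
    t, so the infimum is finite.\<close>
  have lower: "- p (- x) \<le> p (x + t *\<^sub>R v) - t * p v" if "t \<ge> 0" for x t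
    using add[of "x + t *\<^sub>R v" "- x"] scale[OF that, of v] by simp
  have bdd: "bdd_below ((\<lambda>t. p (x + t *\<^sub>R v) - t * p v) ` {0..})" for x
    using lower by (intro bdd_belowI[of _ "- p (- x)"]) auto
  have q_le: "q x \<le> p (x + t *\<^sub>R v) - t * p v" if "t \<ge> 0" for x t
    unfolding q_def using that by (intro cINF_lower[OF bdd]) auto
  have q_ge: "c \<le> q x" if "\<And>t. t \<ge> 0 \<Longrightarrow> c \<le> p (x + t *\<^sub>R v) - t * p v" for c x
    unfolding q_def using that by (intro cINF_greatest) auto
  have q_add: "q (x + y) \<le> q x + q y" for x y
  proof -
    have "q (x + y) - (p (x + t *\<^sub>R v) - t * p v) \<le> q y" if "t \<ge> 0" for t
    proof (rule q_ge)
      fix u :: real assume "u \<ge> 0"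
      \<comment> \<open>Parameters t for x and u for y combine to the admissible parameter t + u for
        x + y.\<close>
      have "q (x + y) \<le> p ((x + t *\<^sub>R v) + (y + u *\<^sub>R v)) - (t + u) * p v"
        using q_le[of "t + u" "x + y"] \<open>t \<ge> 0\<close> \<open>u \<ge> 0\<close> by (simp add: algebra_simps)
      also have "\<dots> \<le> (p (x + t *\<^sub>R v) - t * p v) + (p (y + u *\<^sub>R v) - u * p v)"
        using add[of "x + t *\<^sub>R v" "y + u *\<^sub>R v"] by (simp add: algebra_simps)
      finally show "q (x + y) - (p (x + t *\<^sub>R v) - t * p v) \<le> p (y + u *\<^sub>R v) - u * p v"
        by simp
    qed
    then have "q (x + y) - q y \<le> q x"
      by (intro q_ge) (simp add: algebra_simps)
    then show ?thesis by simp
  qed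
  have scale_le: "q (r *\<^sub>R x) \<le> r * q x" if "r > 0" for r x
  proof -
    have "q (r *\<^sub>R x) / r \<le> q x"
    proof (rule q_ge)
      fix t :: real assume "t \<ge> 0"
      have "q (r *\<^sub>R x) \<le> p (r *\<^sub>R x + (r * t) *\<^sub>R v) - (r * t) * p v"
        using \<open>t \<ge> 0\<close> \<open>r > 0\<close> by (intro q_le) simp
      also have "\<dots> = r * (p (x + t *\<^sub>R v) - t * p v)"
        using scale[of r "x + t *\<^sub>R v"] \<open>r > 0\<close> by (simp add: algebra_simps)
      finally show "q (r *\<^sub>R x) / r \<le> p (x + t *\<^sub>R v) - t * p v"
        using \<open>r > 0\<close> by (simp add: divide_le_eq mult.commute)
    qed
    then show ?thesis
      using that by (simp add: divide_le_eq mult.commute)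
  qed
  have "q 0 = 0"
    using q_le[of 0 0] q_ge[of 0 0] scale[of 0 0] scale[of _ v] by (auto intro!: antisym)
  have q_scale: "q (r *\<^sub>R x) = r * q x" if "r \<ge> 0" for r x
  proof (cases "r = 0")
    case False
    then have "r > 0" using that by simp
    have "r * q x \<le> r * (inverse r * q (r *\<^sub>R x))"
      using scale_le[of "inverse r" "r *\<^sub>R x"] \<open>r > 0\<close> by (intro mult_left_mono) auto
    then show ?thesis
      using scale_le[of r x] \<open>r > 0\<close> by (simp add: mult.assoc[symmetric])
  qed (simp add: \<open>q 0 = 0\<close>)
  show thesis
  proof
    show "sublinear q" using q_add q_scale by (auto simp: sublinear_def)
    show "q x \<le> p x" for x using q_le[of 0 x] by simp
    \<comment> \<open>The parameter t = 1 contributes p 0 - p v.\<close>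
    show "q (- v) \<le> - p v" using q_le[of 1 "- v"] scale[of 0 0] by simp
  qed
qed

lemma sublinear_odd_on_finite:
  assumes "finite A" "sublinear p"
  shows "\<exists>q. sublinear q \<and> (\<forall>x. q x \<le> p x) \<and> (\<forall>v\<in>A. q (- v) = - q v)"
  using assms(1)
proof induction
  case (insert v A)
  then obtain q where q: "sublinear q" "\<And>x. q x \<le> p x" "\<And>w. w \<in> A \<Longrightarrow> q (- w) = - q w"
    by blast
  obtain r where r: "sublinear r" "\<And>x. r x \<le> q x" "r (- v) \<le> - q v"
    using sublinear_improve[OF q(1), of v] by blast
  have "r (- w) = - r w" if "w \<in> insert v A" for w
  proof -
    \<comment> \<open>For w = v this is the improvement just made; for w in \<open>A\<close> it is
      the oddness of \<open>q\<close>, and r \<le> q. Going on to - r w again uses r \<le>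
      q.\<close>
    have "r (- w) \<le> - q w"
      using that r(3) r(2)[of "- w"] q(3)[of w] by auto
    then show ?thesis
      using r(2)[of w] sublinear_minus_ge[OF r(1), of w] by linarith
  qed
  then show ?case
    using r(1,2) q(2) order_trans by blast
qed (use assms(2) in blast)

text \<open>A finite-dimensional Hahn-Banach theorem: \<open>c i\<close> is the value at
  \<open>e i\<close> of a sublinear functional below the norm that is odd at every
  \<open>e i\<close>, hence linear on their span.\<close>

lemma norming_coefficients:
  fixes e :: "'i \<Rightarrow> 'a::real_normed_vector"
  assumes "finite A"
  obtains c where "\<And>a. (\<Sum>i\<in>A. a i * c i) \<le> norm (\<Sum>i\<in>A. a i *\<^sub>R e i)"
    and "norm (\<Sum>i\<in>A. b i *\<^sub>R e i) = (\<Sum>i\<in>A. b i * c i)"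
proof -
  define y where "y = (\<Sum>i\<in>A. b i *\<^sub>R e i)"
  \<comment> \<open>The bound at - y passes to every smaller functional, so the value at y stays
    norming when oddness at the \<open>e i\<close> is arranged next.\<close>
  obtain p where p: "sublinear p" "\<And>x. p x \<le> norm x" "p (- y) \<le> - norm y"
    using sublinear_improve[OF sublinear_norm, of y] by blast
  obtain q where q: "sublinear q" "\<And>x. q x \<le> p x" "\<And>i. i \<in> A \<Longrightarrow> q (- e i) = - q (e i)"
    using sublinear_odd_on_finite[OF finite_imageI[OF assms] p(1), of e] by blast
  have scale: "q (r *\<^sub>R e i) = r * q (e i)" if "i \<in> A" for r i
  proof (cases "r \<ge> 0")
    case False
    then have "q ((- r) *\<^sub>R (- e i)) = (- r) * q (- e i)"
      using q(1) unfolding sublinear_def by (metis less_eq_real_def neg_0_le_iff_le not_le)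
    then show ?thesis using q(3)[OF that] by simp
  qed (use q(1) in \<open>simp add: sublinear_def\<close>)
  have sum_le: "q (\<Sum>i\<in>B. x i) \<le> (\<Sum>i\<in>B. q (x i))" if "finite B" for x :: "'i \<Rightarrow> 'a" and B
    using that
  proof induction
    case (insert i B)
    have "q (x i + sum x B) \<le> q (x i) + q (sum x B)"
      using q(1) by (auto simp: sublinear_def)
    then show ?case using insert by simp
  qed (simp add: sublinear_zero[OF q(1)])
  have le: "q (\<Sum>i\<in>A. a i *\<^sub>R e i) \<le> (\<Sum>i\<in>A. a i * q (e i))" for a
    using sum_le[OF assms, of "\<lambda>i. a i *\<^sub>R e i"] scale by simp
  have eq: "q (\<Sum>i\<in>A. a i *\<^sub>R e i) = (\<Sum>i\<in>A. a i * q (e i))" for a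
    \<comment> \<open>Subadditivity gives one inequality; applied to the negated coefficients it
      gives the other.\<close>
    using le[of a] le[of "\<lambda>i. - a i"] sublinear_minus_ge[OF q(1), of "\<Sum>i\<in>A. a i *\<^sub>R e i"]
    by (simp add: sum_negf)
  show thesis
  proof
    show bound: "(\<Sum>i\<in>A. a i * q (e i)) \<le> norm (\<Sum>i\<in>A. a i *\<^sub>R e i)" for a
      using eq[of a] q(2) p(2) order_trans by metis
    have "q (- y) = - (\<Sum>i\<in>A. b i * q (e i))"
      using eq[of "\<lambda>i. - b i"] by (simp add: y_def sum_negf)
    then show "norm (\<Sum>i\<in>A. b i *\<^sub>R e i) = (\<Sum>i\<in>A. b i * q (e i))"
      using bound[of b] p(3) q(2)[of "- y"] by (simp add: y_def)
  qed
qed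


section \<open>Averaging over signs\<close>

text \<open>Sign patterns are paired so that the two signed sums agree in the k-th term and cancel
  in all others; each pair then contributes at least twice \<bar>t k\<bar>.\<close>

lemma sum_abs_signs_ge:
  fixes t :: "'i \<Rightarrow> real"
  assumes "finite A" "k \<in> A"
  shows "2 ^ card A * \<bar>t k\<bar> \<le> (\<Sum>B\<in>Pow A. \<bar>\<Sum>i\<in>A. (if i \<in> B then - t i else t i)\<bar>)"
proof -
  define s where "s B = (\<Sum>i\<in>A. (if i \<in> B then - t i else t i))" for B
  \<comment> \<open>flips all signs except the one at \<open>k\<close>\<close>
  define flip where "flip B = {i \<in> A. (i \<in> B) = (i = k)}" for B
  have pair: "2 * \<bar>t k\<bar> \<le> \<bar>s B\<bar> + \<bar>s (flip B)\<bar>" if "B \<subseteq> A" for B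
  proof -
    have "s B + s (flip B) = (\<Sum>i\<in>A. if i = k then (if k \<in> B then - 2 * t k else 2 * t k) else 0)"
      unfolding s_def sum.distrib[symmetric] by (intro sum.cong) (auto simp: flip_def)
    also have "\<dots> = (if k \<in> B then - 2 * t k else 2 * t k)"
      using assms by simp
    finally show ?thesis by (auto split: if_splits)
  qed
  \<comment> \<open>\<open>flip\<close> is an involution on the subsets of \<open>A\<close>.\<close>
  have "(\<Sum>B\<in>Pow A. \<bar>s (flip B)\<bar>) = (\<Sum>B\<in>Pow A. \<bar>s B\<bar>)"
    by (rule sum.reindex_bij_witness[of _ flip flip]) (auto simp: flip_def)
  moreover have "(\<Sum>B\<in>Pow A. 2 * \<bar>t k\<bar>) \<le> (\<Sum>B\<in>Pow A. \<bar>s B\<bar> + \<bar>s (flip B)\<bar>)"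
    by (intro sum_mono pair) auto
  ultimately show ?thesis
    using assms(1) by (simp add: sum.distrib card_Pow s_def)
qed


section \<open>Evaluation and induction on the free Banach lattice\<close>

abbreviation FBL_eval :: "'a::banach FBL \<Rightarrow> ('a \<Rightarrow>\<^sub>L real) \<Rightarrow> real" where
  "FBL_eval f \<equiv> H0_fun (FBL_H0 f)"

lemma FBL_eqI: "(\<And>v. FBL_eval f v = FBL_eval g v) \<Longrightarrow> f = g"
  by (metis FBL_H0_inject H0_eqI)

lemma FBL_eval_simps [simp]:
  "FBL_eval 0 v = 0"
  "FBL_eval (f + g) v = FBL_eval f v + FBL_eval g v"
  "FBL_eval (f - g) v = FBL_eval f v - FBL_eval g v"
  "FBL_eval (- f) v = - FBL_eval f v"
  "FBL_eval (r *\<^sub>R f) v = r * FBL_eval f v"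
  "FBL_eval (sup f g) v = max (FBL_eval f v) (FBL_eval g v)"
  "FBL_eval (inf f g) v = min (FBL_eval f v) (FBL_eval g v)"
  "FBL_eval (FBL_delta x) v = blinfun_apply v x"
  by (simp_all add: zero_FBL.rep_eq plus_FBL.rep_eq minus_FBL.rep_eq uminus_FBL.rep_eq
      scaleR_FBL.rep_eq sup_FBL.rep_eq inf_FBL.rep_eq FBL_delta.rep_eq H0_delta.rep_eq)

lemma FBL_eval_bounded_linear: "bounded_linear (\<lambda>f. FBL_eval f v)"
proof (rule bounded_linear_intro)
  show "norm (FBL_eval f v) \<le> norm f * norm v" for f
    using H0_fun_abs_le[of "FBL_H0 f" v] by (simp add: norm_FBL.rep_eq)
qed simp_all

lemma FBL_norm_le:
  "(\<And>n \<phi>. weakly_1_summing n \<phi> \<Longrightarrow> (\<Sum>i<n. \<bar>FBL_eval f (\<phi> i)\<bar>) \<le> C) \<Longrightarrow> norm f \<le> C"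
  by (simp add: norm_FBL.rep_eq norm_H0_le)

lemma FBL_norm_ge: "weakly_1_summing n \<phi> \<Longrightarrow> (\<Sum>i<n. \<bar>FBL_eval f (\<phi> i)\<bar>) \<le> norm f"
  by (simp add: norm_FBL.rep_eq norm_H0_ge)

lemma weakly_1_summing_bound:
  assumes "weakly_1_summing n \<phi>"
  shows "(\<Sum>i<n. \<bar>blinfun_apply (\<phi> i) x\<bar>) \<le> norm x"
proof (cases "x = 0")
  case False
  have "(\<Sum>i<n. \<bar>blinfun_apply (\<phi> i) (x /\<^sub>R norm x)\<bar>) \<le> 1"
    using assms False by (auto simp: weakly_1_summing_def)
  then have "(\<Sum>i<n. \<bar>blinfun_apply (\<phi> i) x\<bar>) / norm x \<le> 1"
    by (simp add: blinfun.scaleR_right abs_mult sum_distrib_left divide_inverse_commute)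
  then show ?thesis
    using False by (simp add: divide_le_eq)
qed simp

lemma norm_FBL_delta_le: "norm (FBL_delta x) \<le> norm x"
  by (rule FBL_norm_le) (simp add: weakly_1_summing_bound)

lemma norm_FBL_modulus: "norm (sup f (- f)) = norm (f :: 'a::banach FBL)"
proof -
  have "\<bar>max a (- a)\<bar> = \<bar>a\<bar>" for a :: real by auto
  then have "fbl_norm (FBL_eval (sup f (- f))) = fbl_norm (FBL_eval f)"
    by (simp add: fbl_norm_def)
  then show ?thesis
    by (simp only: norm_FBL.rep_eq norm_H0_def H0_norm_def)
qed

text \<open>The elements satisfying \<open>P\<close> form a closed sublattice containing the
  generators, so they exhaust the hull.\<close>

lemma FBL_induct:
  fixes f :: "'a::banach FBL"
  assumes delta: "\<And>x. P (FBL_delta x)"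
    and add: "\<And>f g. P f \<Longrightarrow> P g \<Longrightarrow> P (f + g)"
    and scale: "\<And>r f. P f \<Longrightarrow> P (r *\<^sub>R f)"
    and sup: "\<And>f g. P f \<Longrightarrow> P g \<Longrightarrow> P (sup f g)"
    and inf: "\<And>f g. P f \<Longrightarrow> P g \<Longrightarrow> P (inf f g)"
    and lim: "\<And>F f. (\<And>k. P (F k)) \<Longrightarrow> F \<longlonglongrightarrow> f \<Longrightarrow> P f"
  shows "P f"
proof -
  define S where "S = FBL_H0 ` {f. P f}"
  have "subspace S"
    unfolding subspace_def
  proof (intro conjI ballI allI)
    have "P 0"
      using scale[OF delta, of 0] by simp
    then show "0 \<in> S"
      unfolding S_def zero_FBL.rep_eq[symmetric] by blast
  next
    fix x y assume "x \<in> S" "y \<in> S"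
    then show "x + y \<in> S"
      unfolding S_def by (auto simp: plus_FBL.rep_eq[symmetric] intro!: imageI add)
  next
    fix r x assume "x \<in> S"
    then show "r *\<^sub>R x \<in> S"
      unfolding S_def by (auto simp: scaleR_FBL.rep_eq[symmetric] intro!: imageI scale)
  qed
  moreover have "closed S"
    unfolding closed_sequential_limits
  proof (intro allI impI)
    fix x l assume x: "(\<forall>k. x k \<in> S) \<and> x \<longlonglongrightarrow> l"
    then have "\<forall>k. \<exists>g. P g \<and> x k = FBL_H0 g"
      unfolding S_def by blast
    then obtain F where F: "\<And>k. P (F k)" "\<And>k. x k = FBL_H0 (F k)"
      by metis
    have "l \<in> closed_sublattice hull (range H0_delta)"
      using closed_sequentially[OF FBL_H0_closed(8), of x l] x F(2) FBL_H0 by auto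
    then have l: "FBL_H0 (Abs_FBL l) = l"
      by (rule Abs_FBL_inverse)
    have "(\<lambda>k. dist (F k) (Abs_FBL l)) = (\<lambda>k. dist (x k) l)"
      by (simp add: dist_norm norm_FBL.rep_eq minus_FBL.rep_eq F(2) l)
    then have "F \<longlonglongrightarrow> Abs_FBL l"
      using x by (simp add: tendsto_dist_iff[of F] tendsto_dist_iff[of x])
    then have "P (Abs_FBL l)"
      using F(1) lim by blast
    then show "l \<in> S"
      unfolding S_def using l by (metis imageI mem_Collect_eq)
  qed
  moreover have "sup x y \<in> S \<and> inf x y \<in> S" if "x \<in> S" "y \<in> S" for x y
    using that unfolding S_def
    by (auto simp: sup_FBL.rep_eq[symmetric] inf_FBL.rep_eq[symmetric] intro!: imageI sup inf)
  ultimately have "closed_sublattice S"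
    by (simp add: closed_sublattice_def)
  moreover have "range H0_delta \<subseteq> S"
    unfolding S_def using delta by (auto simp: FBL_delta.rep_eq[symmetric])
  ultimately have "closed_sublattice hull (range H0_delta) \<subseteq> S"
    by (intro hull_minimal)
  then have "FBL_H0 f \<in> S"
    using FBL_H0 by blast
  then show ?thesis
    unfolding S_def by (auto dest: FBL_H0_inject[THEN iffD1])
qed

text \<open>Agreement on the generators propagates through lattice operations, because suprema and
  infima are unique, and through limits by continuity. This makes the \<open>THE\<close> in
  \<open>FBL_beta\<close> determinate.\<close>

lemma lattice_hom_FBL_unique:
  assumes "banach_lattice le" "lattice_hom (\<le>) le \<beta>" "lattice_hom (\<le>) le \<gamma>"
    and eq: "\<And>x. \<beta> (FBL_delta x) = \<gamma> (FBL_delta x)"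
  shows "\<beta> = \<gamma>"
proof
  fix f
  interpret L: banach_lattice le by fact
  interpret \<beta>: bounded_linear \<beta> using assms(2) by (simp add: lattice_hom_def)
  interpret \<gamma>: bounded_linear \<gamma> using assms(3) by (simp add: lattice_hom_def)
  have homs: "is_sup le (\<delta> f) (\<delta> g) (\<delta> (sup f g))" "is_inf le (\<delta> f) (\<delta> g) (\<delta> (inf f g))"
    if "\<delta> \<in> {\<beta>, \<gamma>}" for f g \<delta>
    using assms(2,3) that by (auto simp: lattice_hom_def is_sup_iff is_inf_iff)
  have sup_unique: "s = t" if "is_sup le x y s" "is_sup le x y t" for x y s t
    using that L.antisym unfolding is_sup_def by blast
  have inf_unique: "s = t" if "is_inf le x y s" "is_inf le x y t" for x y s t
    using that L.antisym unfolding is_inf_def by blast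
  show "\<beta> f = \<gamma> f"
  proof (induction f rule: FBL_induct)
    case (6 F f)
    then show ?case
      using LIMSEQ_unique[OF \<beta>.tendsto[of F f] \<gamma>.tendsto[of F f, folded 6(1)]] by simp
  next
    case (4 f g)
    then show ?case using homs(1)[of \<beta> f g] homs(1)[of \<gamma> f g] by (auto intro: sup_unique)
  next
    case (5 f g)
    then show ?case using homs(2)[of \<beta> f g] homs(2)[of \<gamma> f g] by (auto intro: inf_unique)
  qed (simp_all add: eq \<beta>.add \<gamma>.add \<beta>.scaleR \<gamma>.scaleR)
qed


section \<open>Spaces with a 1-unconditional basis\<close>

locale unconditional_basis =
  fixes e :: "nat \<Rightarrow> 'a::banach"
  assumes unconditional: "one_unconditional_basis e"
begin

abbreviation coord :: "nat \<Rightarrow> 'a \<Rightarrow> real" where "coord \<equiv> basis_coord e"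

lemma ex1_coeff: "\<exists>!a. (\<lambda>n. a n *\<^sub>R e n) sums x"
  using unconditional by (simp add: one_unconditional_basis_def schauder_basis_def)

lemma coord_sums: "(\<lambda>n. coord n x *\<^sub>R e n) sums x"
  unfolding basis_coord_def using theI'[OF ex1_coeff] .

lemma coord_unique: "(\<lambda>n. a n *\<^sub>R e n) sums x \<Longrightarrow> coord n x = a n"
  using ex1_coeff[of x] coord_sums[of x] by metis

lemma coord_eqI: "(\<And>n. coord n x = coord n y) \<Longrightarrow> x = y"
  using coord_sums[of x] coord_sums[of y] sums_unique2 by force

lemma coord_suminf: "summable (\<lambda>n. a n *\<^sub>R e n) \<Longrightarrow> coord n (\<Sum>n. a n *\<^sub>R e n) = a n"
  by (intro coord_unique summable_sums)

lemma coord_add [simp]: "coord n (x + y) = coord n x + coord n y"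
  by (rule coord_unique) (simp add: scaleR_add_left sums_add coord_sums)

lemma coord_scaleR [simp]: "coord n (r *\<^sub>R x) = r * coord n x"
  using sums_scaleR_right[OF coord_sums[of x], of r] by (intro coord_unique) simp

lemma coord_minus [simp]: "coord n (- x) = - coord n x"
  using coord_scaleR[of n "- 1" x] by simp

lemma coord_basis: "coord n (e m) = (if n = m then 1 else 0)"
proof (rule coord_unique)
  show "(\<lambda>n. (if n = m then 1 else 0 :: real) *\<^sub>R e n) sums e m"
    using sums_single[of m e] by (simp add: if_distrib[of "\<lambda>r. r *\<^sub>R _"] cong: if_cong)
qed

lemma basis_nonzero: "e n \<noteq> 0"
proof
  assume "e n = 0"
  then have "coord n (e n) = 0"
    using coord_scaleR[of n 0 0] by simp
  then show False by (simp add: coord_basis)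
qed

section \<open>Monotonicity of the norm and dominated series\<close>

lemma norm_sum_mono:
  assumes "finite A" "\<And>i. i \<in> A \<Longrightarrow> \<bar>a i\<bar> \<le> \<bar>b i\<bar>"
  shows "norm (\<Sum>i\<in>A. a i *\<^sub>R e i) \<le> norm (\<Sum>i\<in>A. b i *\<^sub>R e i)"
proof -
  \<comment> \<open>Unconditionality speaks of initial segments only, so the coefficients are padded
    with zeros.\<close>
  obtain n where n: "A \<subseteq> {..<n}"
    using finite_nat_bounded[OF assms(1)] by auto
  have eq: "(\<Sum>i\<in>A. c i *\<^sub>R e i) = (\<Sum>i<n. (if i \<in> A then c i else 0) *\<^sub>R e i)" for c
    using n by (intro sum.mono_neutral_cong_left) auto
  show ?thesis
    unfolding eq using unconditional assms(2) by (auto simp: one_unconditional_basis_def)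
qed

lemma norm_sum_subset_mono:
  assumes "finite B" "A \<subseteq> B"
  shows "norm (\<Sum>i\<in>A. a i *\<^sub>R e i) \<le> norm (\<Sum>i\<in>B. a i *\<^sub>R e i)"
proof -
  have "(\<Sum>i\<in>A. a i *\<^sub>R e i) = (\<Sum>i\<in>B. (if i \<in> A then a i else 0) *\<^sub>R e i)"
    using assms by (intro sum.mono_neutral_cong_left) auto
  then show ?thesis
    using norm_sum_mono[OF assms(1), of "\<lambda>i. if i \<in> A then a i else 0" a] by simp
qed

text \<open>The norms of the partial sums increase with limit \<open>norm x\<close>.\<close>

lemma norm_partial_sum_le: "norm (\<Sum>i<n. coord i x *\<^sub>R e i) \<le> norm x"
proof (rule tendsto_lowerbound)
  show "(\<lambda>N. norm (\<Sum>i<N. coord i x *\<^sub>R e i)) \<longlonglongrightarrow> norm x"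
    using coord_sums[of x] unfolding sums_def by (rule tendsto_norm)
  show "\<forall>\<^sub>F N in sequentially. norm (\<Sum>i<n. coord i x *\<^sub>R e i) \<le> norm (\<Sum>i<N. coord i x *\<^sub>R e i)"
    using eventually_ge_at_top[of n] by eventually_elim (intro norm_sum_subset_mono, auto)
qed simp

lemma norm_le_of_coord_le:
  assumes "\<And>n. \<bar>coord n x\<bar> \<le> \<bar>coord n y\<bar>"
  shows "norm x \<le> norm y"
proof (rule tendsto_upperbound)
  show "(\<lambda>N. norm (\<Sum>i<N. coord i x *\<^sub>R e i)) \<longlonglongrightarrow> norm x"
    using coord_sums[of x] unfolding sums_def by (rule tendsto_norm)
  show "\<forall>\<^sub>F N in sequentially. norm (\<Sum>i<N. coord i x *\<^sub>R e i) \<le> norm y"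
    using norm_sum_mono[of _ "\<lambda>i. coord i x" "\<lambda>i. coord i y"] assms norm_partial_sum_le[of y]
    by (intro always_eventually allI) (meson finite_lessThan order_trans)
qed simp

lemma summable_mono:
  assumes "summable (\<lambda>n. b n *\<^sub>R e n)" "\<And>n. \<bar>a n\<bar> \<le> \<bar>b n\<bar>"
  shows "summable (\<lambda>n. a n *\<^sub>R e n)"
  unfolding summable_Cauchy
proof (intro allI impI)
  fix r :: real assume "r > 0"
  then obtain N where "\<forall>m\<ge>N. \<forall>n. norm (\<Sum>i\<in>{m..<n}. b i *\<^sub>R e i) < r"
    using assms(1) unfolding summable_Cauchy by blast
  then show "\<exists>N. \<forall>m\<ge>N. \<forall>n. norm (\<Sum>i\<in>{m..<n}. a i *\<^sub>R e i) < r"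
    using norm_sum_mono[of "{_..<_}" a b] assms(2) by (meson finite_atLeastLessThan le_less_trans)
qed

text \<open>With \<open>c\<close> a coordinatewise maximum or minimum of \<open>a\<close> and
  \<open>b\<close>, this yields the lattice operations and the lattice steps in the induction for
  \<beta>.\<close>

lemma summable_dominated:
  assumes "summable (\<lambda>n. a n *\<^sub>R e n)" "summable (\<lambda>n. b n *\<^sub>R e n)" "\<And>n. \<bar>c n\<bar> \<le> \<bar>a n\<bar> + \<bar>b n\<bar>"
  shows "summable (\<lambda>n. c n *\<^sub>R e n)"
proof (rule summable_mono)
  have "summable (\<lambda>n. \<bar>a n\<bar> *\<^sub>R e n)" "summable (\<lambda>n. \<bar>b n\<bar> *\<^sub>R e n)"
    using summable_mono[OF assms(1)] summable_mono[OF assms(2)] by simp_all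
  then show "summable (\<lambda>n. (\<bar>a n\<bar> + \<bar>b n\<bar>) *\<^sub>R e n)"
    by (simp add: scaleR_add_left summable_add)
qed (use assms(3) in \<open>simp add: abs_of_nonneg\<close>)

lemma coord_summable: "summable (\<lambda>n. coord n x *\<^sub>R e n)"
  using coord_sums sums_summable by blast

section \<open>The coordinatewise lattice operations\<close>

lemma ex_coord_max: "\<exists>z. \<forall>n. coord n z = max (coord n x) (coord n y)"
  using coord_suminf[OF summable_dominated[OF coord_summable[of x] coord_summable[of y],
      of "\<lambda>n. max (coord n x) (coord n y)"]] by fastforce

lemma ex_coord_min: "\<exists>z. \<forall>n. coord n z = min (coord n x) (coord n y)"
  using coord_suminf[OF summable_dominated[OF coord_summable[of x] coord_summable[of y],
      of "\<lambda>n. min (coord n x) (coord n y)"]] by fastforce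

lemma is_sup_coord_iff:
  "is_sup (coord_le e) x y s \<longleftrightarrow> (\<forall>n. coord n s = max (coord n x) (coord n y))"
proof
  assume s: "is_sup (coord_le e) x y s"
  \<comment> \<open>The coordinatewise maximum is realised by an element, and comparing the given
    supremum with it fixes the coordinates.\<close>
  obtain z where z: "\<And>n. coord n z = max (coord n x) (coord n y)"
    using ex_coord_max by blast
  then have "coord_le e x z" "coord_le e y z"
    by (auto simp: coord_le_def)
  then have "coord_le e s z"
    using s by (simp add: is_sup_def)
  then have "coord n s \<le> coord n z" "coord n x \<le> coord n s" "coord n y \<le> coord n s" for n
    using s by (auto simp: is_sup_def coord_le_def)
  then show "\<forall>n. coord n s = max (coord n x) (coord n y)"
    using z by (metis antisym max.boundedI)
qed (auto simp: is_sup_def coord_le_def)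

lemma is_inf_coord_iff:
  "is_inf (coord_le e) x y s \<longleftrightarrow> (\<forall>n. coord n s = min (coord n x) (coord n y))"
proof
  assume s: "is_inf (coord_le e) x y s"
  obtain z where z: "\<And>n. coord n z = min (coord n x) (coord n y)"
    using ex_coord_min by blast
  then have "coord_le e z x" "coord_le e z y"
    by (auto simp: coord_le_def)
  then have "coord_le e z s"
    using s by (simp add: is_inf_def)
  then have "coord n z \<le> coord n s" "coord n s \<le> coord n x" "coord n s \<le> coord n y" for n
    using s by (auto simp: is_inf_def coord_le_def)
  then show "\<forall>n. coord n s = min (coord n x) (coord n y)"
    using z by (metis antisym min.boundedI)
qed (auto simp: is_inf_def coord_le_def)

lemma banach_lattice_coord: "banach_lattice (coord_le e)"
proof
  show "\<exists>s. is_sup (coord_le e) x y s" "\<exists>s. is_inf (coord_le e) x y s" for x y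
    using ex_coord_max ex_coord_min by (simp_all add: is_sup_coord_iff is_inf_coord_iff)
  show "norm x \<le> norm y"
    if "is_sup (coord_le e) x (- x) u" "is_sup (coord_le e) y (- y) v" "coord_le e u v" for x y u v
  proof (rule norm_le_of_coord_le)
    fix n
    have "max (coord n x) (- coord n x) \<le> max (coord n y) (- coord n y)"
      using that by (metis coord_le_def coord_minus is_sup_coord_iff)
    then show "\<bar>coord n x\<bar> \<le> \<bar>coord n y\<bar>" by linarith
  qed
  show "x = y" if "coord_le e x y" "coord_le e y x" for x y
    using that by (intro coord_eqI antisym) (auto simp: coord_le_def)
  show "coord_le e x z" if "coord_le e x y" "coord_le e y z" for x y z
    using that unfolding coord_le_def by (meson order_trans)
qed (simp_all add: coord_le_def mult_left_mono)

section \<open>The biorthogonal functionals as elements of the dual\<close>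

lemma coord_bounded_linear: "bounded_linear (coord n)"
proof (rule bounded_linear_intro)
  fix x
  have "norm (\<Sum>i\<in>{n}. coord i x *\<^sub>R e i) \<le> norm (\<Sum>i<Suc n. coord i x *\<^sub>R e i)"
    by (rule norm_sum_subset_mono) auto
  also have "\<dots> \<le> norm x"
    by (rule norm_partial_sum_le)
  finally show "norm (coord n x) \<le> norm x * inverse (norm (e n))"
    using basis_nonzero[of n] by (simp add: pos_le_divide_eq flip: divide_inverse)
qed simp_all

definition coord_fun :: "nat \<Rightarrow> 'a \<Rightarrow>\<^sub>L real" where
  "coord_fun n = Blinfun (coord n)"

lemma coord_fun_apply [simp]: "blinfun_apply (coord_fun n) x = coord n x"
  by (simp add: coord_fun_def bounded_linear_Blinfun_apply coord_bounded_linear)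


section \<open>The lattice homomorphism \<open>\<beta>\<close>\<close>

text \<open>By duality the norm equals a sum of b n * c n with norming coefficients
  \<open>c\<close>. Unconditionality makes the functionals \<open>coord_fun n\<close> scaled by
  \<bar>c n\<bar> weakly 1-summing, so the free norm bounds that sum.\<close>

lemma norm_eval_coord_sum_le:
  "norm (\<Sum>n<N. FBL_eval f (coord_fun n) *\<^sub>R e n) \<le> norm f"
proof -
  define b where "b n = FBL_eval f (coord_fun n)" for n
  obtain c where c: "\<And>a. (\<Sum>n<N. a n * c n) \<le> norm (\<Sum>n<N. a n *\<^sub>R e n)"
    "norm (\<Sum>n<N. b n *\<^sub>R e n) = (\<Sum>n<N. b n * c n)"
    using norming_coefficients[of "{..<N}"] by blast
  have "weakly_1_summing N (\<lambda>n. \<bar>c n\<bar> *\<^sub>R coord_fun n)"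
    unfolding weakly_1_summing_def
  proof
    fix x :: 'a assume "x \<in> cball 0 1"
    \<comment> \<open>The signs make a n * c n = \<bar>c n\<bar> * \<bar>coord n x\<bar> without
      increasing any coefficient in modulus.\<close>
    define a where "a n = sgn (c n) * \<bar>coord n x\<bar>" for n
    have "(\<Sum>n<N. \<bar>blinfun_apply (\<bar>c n\<bar> *\<^sub>R coord_fun n) x\<bar>) = (\<Sum>n<N. a n * c n)"
      by (intro sum.cong) (simp_all add: a_def abs_mult blinfun.scaleR_left sgn_if)
    also have "\<dots> \<le> norm (\<Sum>n<N. a n *\<^sub>R e n)"
      by (rule c(1))
    also have "\<dots> \<le> norm (\<Sum>n<N. coord n x *\<^sub>R e n)"
      by (rule norm_sum_mono) (auto simp: a_def abs_mult sgn_if)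
    also have "\<dots> \<le> norm x"
      by (rule norm_partial_sum_le)
    finally show "(\<Sum>n<N. \<bar>blinfun_apply (\<bar>c n\<bar> *\<^sub>R coord_fun n) x\<bar>) \<le> 1"
      using \<open>x \<in> cball 0 1\<close> by simp
  qed
  then have bound: "(\<Sum>n<N. \<bar>FBL_eval f (\<bar>c n\<bar> *\<^sub>R coord_fun n)\<bar>) \<le> norm f"
    by (rule FBL_norm_ge)
  \<comment> \<open>Homogeneity covers positive scalars only; the scalar 0 needs the value at the
    zero functional.\<close>
  have "FBL_eval f (\<bar>r\<bar> *\<^sub>R v) = \<bar>r\<bar> * FBL_eval f v" for r v
    by (cases "r = 0") (simp_all add: H0_fun_scale H0_fun_0)
  then have "(\<Sum>n<N. b n * c n) \<le> (\<Sum>n<N. \<bar>FBL_eval f (\<bar>c n\<bar> *\<^sub>R coord_fun n)\<bar>)"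
    by (intro sum_mono) (metis abs_ge_self abs_mult abs_abs b_def mult.commute)
  then show ?thesis
    using bound c(2) by (simp add: b_def)
qed

text \<open>For generators this is the basis expansion, and for suprema and infima domination
  applies. In the limit case \<open>norm_eval_coord_sum_le\<close> controls the blocks of f - F k
  uniformly.\<close>

lemma summable_eval_coord: "summable (\<lambda>n. FBL_eval f (coord_fun n) *\<^sub>R e n)"
proof (induction f rule: FBL_induct)
  case (6 F f)
  show ?case
    unfolding summable_Cauchy
  proof (intro allI impI)
    fix r :: real assume "r > 0"
    then obtain k where k: "norm (f - F k) < r / 2"
      using LIMSEQ_D[OF 6(2), of "r / 2"] by (auto simp: norm_minus_commute)
    obtain N where N: "\<forall>m\<ge>N. \<forall>n. norm (\<Sum>i\<in>{m..<n}. FBL_eval (F k) (coord_fun i) *\<^sub>R e i) < r / 2"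
      using 6(1)[of k] \<open>r > 0\<close> unfolding summable_Cauchy by (meson half_gt_zero)
    have "norm (\<Sum>i\<in>{m..<n}. FBL_eval f (coord_fun i) *\<^sub>R e i) < r" if "m \<ge> N" for m n
    proof -
      have "(\<Sum>i\<in>{m..<n}. FBL_eval f (coord_fun i) *\<^sub>R e i) =
          (\<Sum>i\<in>{m..<n}. FBL_eval (F k) (coord_fun i) *\<^sub>R e i) +
          (\<Sum>i\<in>{m..<n}. FBL_eval (f - F k) (coord_fun i) *\<^sub>R e i)"
        by (simp add: sum.distrib[symmetric] scaleR_add_left[symmetric])
      moreover have "norm (\<Sum>i\<in>{m..<n}. FBL_eval (f - F k) (coord_fun i) *\<^sub>R e i) \<le> norm (f - F k)"
        using norm_sum_subset_mono[of "{..<n}" "{m..<n}"] norm_eval_coord_sum_le[of "f - F k" n]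
        by (meson atLeastLessThan_iff finite_lessThan lessThan_iff order_trans subsetI)
      ultimately show ?thesis
        using N[rule_format, OF that, of n] k norm_triangle_ineq by (smt (verit) field_sum_of_halves)
    qed
    then show "\<exists>N. \<forall>m\<ge>N. \<forall>n. norm (\<Sum>i\<in>{m..<n}. FBL_eval f (coord_fun i) *\<^sub>R e i) < r"
      by blast
  qed
next
  case (1 x)
  then show ?case by (simp add: coord_summable)
next
  case (2 f g)
  then show ?case by (simp add: scaleR_add_left summable_add)
next
  case (3 r f)
  then show ?case using summable_scaleR_right[of _ r] by fastforce
next
  case (4 f g)
  then show ?case by (rule summable_dominated) auto
next
  case (5 f g)
  then show ?case by (rule summable_dominated) auto
qed

definition beta :: "'a FBL \<Rightarrow> 'a" where
  "beta f = (\<Sum>n. FBL_eval f (coord_fun n) *\<^sub>R e n)"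

lemma coord_beta [simp]: "coord n (beta f) = FBL_eval f (coord_fun n)"
  unfolding beta_def by (rule coord_suminf[OF summable_eval_coord])

lemma norm_beta_le: "norm (beta f) \<le> norm f"
proof (rule tendsto_upperbound)
  show "(\<lambda>N. norm (\<Sum>n<N. FBL_eval f (coord_fun n) *\<^sub>R e n)) \<longlonglongrightarrow> norm (beta f)"
    unfolding beta_def by (intro tendsto_norm summable_LIMSEQ summable_eval_coord)
qed (simp_all add: norm_eval_coord_sum_le)

lemma beta_delta: "beta (FBL_delta x) = x"
  by (rule coord_eqI) simp

lemma lattice_hom_beta: "lattice_hom (\<le>) (coord_le e) beta"
proof -
  have "bounded_linear beta"
    by (rule bounded_linear_intro[of _ 1]) (auto intro: coord_eqI simp: norm_beta_le)
  then show ?thesis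
    by (simp add: lattice_hom_def is_sup_iff is_inf_iff is_sup_coord_iff is_inf_coord_iff)
qed

lemma FBL_beta_eq: "FBL_beta (coord_le e) = beta"
  unfolding FBL_beta_def
proof (rule the_equality)
  show "lattice_hom (\<le>) (coord_le e) beta \<and> beta \<circ> FBL_delta = id"
    using lattice_hom_beta by (auto simp: beta_delta)
  show "\<gamma> = beta" if "lattice_hom (\<le>) (coord_le e) \<gamma> \<and> \<gamma> \<circ> FBL_delta = id" for \<gamma>
    using that lattice_hom_beta
    by (intro lattice_hom_FBL_unique[OF banach_lattice_coord]) (auto simp: beta_delta fun_eq_iff)
qed


section \<open>The lifting\<close>

definition weight :: "nat \<Rightarrow> real" where
  "weight n = (1 / 2) ^ n / norm (e n)"

lemma weight_pos: "weight n > 0"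
  using basis_nonzero[of n] by (simp add: weight_def)

definition modulus_delta :: "nat \<Rightarrow> 'a FBL" where
  "modulus_delta n = sup (FBL_delta (e n)) (- FBL_delta (e n))"

lemma eval_modulus_delta [simp]: "FBL_eval (modulus_delta n) v = \<bar>blinfun_apply v (e n)\<bar>"
  by (auto simp: modulus_delta_def)

definition total :: "'a FBL" where
  "total = (\<Sum>n. weight n *\<^sub>R modulus_delta n)"

lemma total_sums: "(\<lambda>n. weight n *\<^sub>R modulus_delta n) sums total"
  unfolding total_def
proof (rule summable_sums, rule summable_comparison_test')
  show "summable (\<lambda>n. (1 / 2 :: real) ^ n)"
    by (rule summable_geometric) simp
  \<comment> \<open>The denominator in \<open>weight\<close> cancels the norm of the modulus and
    leaves a geometric majorant.\<close>
  show "norm (weight n *\<^sub>R modulus_delta n) \<le> (1 / 2) ^ n" for n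
    using norm_FBL_delta_le[of "e n"] basis_nonzero[of n]
    by (simp add: modulus_delta_def norm_FBL_modulus weight_def divide_le_eq mult_left_mono)
qed

lemma eval_total_sums: "(\<lambda>n. weight n * \<bar>blinfun_apply v (e n)\<bar>) sums FBL_eval total v"
  using bounded_linear.sums[OF FBL_eval_bounded_linear total_sums, of v] by simp

text \<open>All terms are nonnegative. One index gives the domination of \<open>lift_basis\<close>,
  two indices its disjointness.\<close>

lemma eval_total_ge:
  assumes "finite A"
  shows "(\<Sum>n\<in>A. weight n * \<bar>blinfun_apply v (e n)\<bar>) \<le> FBL_eval total v"
  using sum_le_suminf[OF sums_summable[OF eval_total_sums] assms] sums_unique[OF eval_total_sums]
  by (simp add: less_imp_le[OF weight_pos])

lemma eval_total_coord: "FBL_eval total (coord_fun n) = weight n"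
proof (rule sums_unique2[OF eval_total_sums])
  show "(\<lambda>m. weight m * \<bar>blinfun_apply (coord_fun n) (e m)\<bar>) sums weight n"
    using sums_single[of n weight] by (rule sums_cong[THEN iffD1, rotated]) (simp add: coord_basis)
qed

section \<open>Disjoint positive elements over the basis\<close>

definition lift_basis :: "nat \<Rightarrow> 'a FBL" where
  "lift_basis n = sup 0 (2 *\<^sub>R modulus_delta n - (1 / weight n) *\<^sub>R total)"

lemma eval_lift_basis:
  "FBL_eval (lift_basis n) v = max 0 (2 * \<bar>blinfun_apply v (e n)\<bar> - FBL_eval total v / weight n)"
  by (simp add: lift_basis_def)

lemma lift_basis_nonneg: "0 \<le> FBL_eval (lift_basis n) v"
  by (simp add: eval_lift_basis)

lemma lift_basis_le: "FBL_eval (lift_basis n) v \<le> \<bar>blinfun_apply v (e n)\<bar>"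
  using eval_total_ge[of "{n}" v] weight_pos[of n]
  by (simp add: eval_lift_basis pos_le_divide_eq mult.commute)

text \<open>At \<open>coord_fun n\<close> the value is 2 - 1; at another \<open>coord_fun m\<close>
  the modulus vanishes and the remaining negative term is cut off at 0.\<close>

lemma lift_basis_coord: "FBL_eval (lift_basis n) (coord_fun m) = (if n = m then 1 else 0)"
  using weight_pos[of n] weight_pos[of m]
  by (auto simp: eval_lift_basis coord_basis eval_total_coord)

lemma lift_basis_disjoint:
  assumes "FBL_eval (lift_basis n) v \<noteq> 0" "FBL_eval (lift_basis m) v \<noteq> 0"
  shows "n = m"
proof (rule ccontr)
  assume "n \<noteq> m"
  have "FBL_eval total v < 2 * (weight k * \<bar>blinfun_apply v (e k)\<bar>)"
    if "FBL_eval (lift_basis k) v \<noteq> 0" for k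
  proof -
    have "FBL_eval total v / weight k < 2 * \<bar>blinfun_apply v (e k)\<bar>"
      using that by (auto simp: eval_lift_basis max_def split: if_splits)
    then show ?thesis
      using weight_pos[of k] by (simp add: pos_divide_less_eq mult_ac)
  qed
  \<comment> \<open>Two distinct terms, each above half of the total, would together exceed
    it.\<close>
  from this[OF assms(1)] this[OF assms(2)] show False
    using eval_total_ge[of "{n, m}" v] \<open>n \<noteq> m\<close> by simp
qed

text \<open>If \<open>FBL_eval (lift_basis n) v\<close> vanishes for all \<open>n\<close>, the index is arbitrary.\<close>

definition active :: "('a \<Rightarrow>\<^sub>L real) \<Rightarrow> nat" where
  "active v = (SOME n. FBL_eval (lift_basis n) v \<noteq> 0)"

lemma lift_basis_active:
  assumes "n \<noteq> active v"
  shows "FBL_eval (lift_basis n) v = 0"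
proof (rule ccontr)
  assume n: "FBL_eval (lift_basis n) v \<noteq> 0"
  then have "FBL_eval (lift_basis (active v)) v \<noteq> 0"
    unfolding active_def by (rule someI)
  then show False
    using lift_basis_disjoint[OF n] assms by blast
qed

section \<open>The norm estimate by averaging over signs\<close>

lemma norm_lift_sum_le:
  assumes "finite A"
  shows "norm (\<Sum>n\<in>A. a n *\<^sub>R lift_basis n) \<le> norm (\<Sum>n\<in>A. a n *\<^sub>R e n)"
proof (rule FBL_norm_le)
  fix k and \<phi> :: "nat \<Rightarrow> 'a \<Rightarrow>\<^sub>L real"
  assume \<phi>: "weakly_1_summing k \<phi>"
  define f where "f = (\<Sum>n\<in>A. a n *\<^sub>R lift_basis n)"
  define t where "t i n = blinfun_apply (\<phi> i) (a n *\<^sub>R e n)" for i n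
  define x where "x B = (\<Sum>n\<in>A. (if n \<in> B then - a n else a n) *\<^sub>R e n)" for B
  have x: "(\<Sum>n\<in>A. if n \<in> B then - t i n else t i n) = blinfun_apply (\<phi> i) (x B)" for B i
    unfolding x_def t_def blinfun.sum_right
    by (intro sum.cong) (auto simp: blinfun.minus_right)
  have "2 ^ card A * \<bar>FBL_eval f (\<phi> i)\<bar> \<le> (\<Sum>B\<in>Pow A. \<bar>blinfun_apply (\<phi> i) (x B)\<bar>)" for i
  proof -
    have "FBL_eval f (\<phi> i) = (\<Sum>n\<in>A. a n * FBL_eval (lift_basis n) (\<phi> i))"
      unfolding f_def
      by (subst linear_sum[OF bounded_linear.linear[OF FBL_eval_bounded_linear]]) simp
    \<comment> \<open>By disjointness at most one summand survives at each functional, so a bound by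
      a single term \<open>t i n\<close> suffices.\<close>
    also have "\<dots> = (\<Sum>n\<in>A. if n = active (\<phi> i) then a n * FBL_eval (lift_basis n) (\<phi> i) else 0)"
      by (intro sum.cong) (auto simp: lift_basis_active)
    finally have eq: "FBL_eval f (\<phi> i) = (if active (\<phi> i) \<in> A then
        a (active (\<phi> i)) * FBL_eval (lift_basis (active (\<phi> i))) (\<phi> i) else 0)"
      using assms by simp
    show ?thesis
    proof (cases "active (\<phi> i) \<in> A")
      case True
      have "\<bar>FBL_eval f (\<phi> i)\<bar> \<le> \<bar>t i (active (\<phi> i))\<bar>"
        using True eq lift_basis_le lift_basis_nonneg
        by (simp add: t_def blinfun.scaleR_right abs_mult mult_left_mono)
      then have "2 ^ card A * \<bar>FBL_eval f (\<phi> i)\<bar> \<le> 2 ^ card A * \<bar>t i (active (\<phi> i))\<bar>"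
        by simp
      also have "\<dots> \<le> (\<Sum>B\<in>Pow A. \<bar>blinfun_apply (\<phi> i) (x B)\<bar>)"
        using sum_abs_signs_ge[OF assms True, of "t i"] by (simp add: x)
      finally show ?thesis .
    qed (simp add: eq sum_nonneg)
  qed
  then have "2 ^ card A * (\<Sum>i<k. \<bar>FBL_eval f (\<phi> i)\<bar>)
      \<le> (\<Sum>i<k. \<Sum>B\<in>Pow A. \<bar>blinfun_apply (\<phi> i) (x B)\<bar>)"
    unfolding sum_distrib_left by (intro sum_mono)
  \<comment> \<open>With the sign pattern fixed first, weak summability applies to the single vector
    \<open>x B\<close>.\<close>
  also have "\<dots> = (\<Sum>B\<in>Pow A. \<Sum>i<k. \<bar>blinfun_apply (\<phi> i) (x B)\<bar>)"
    by (rule sum.swap)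
  also have "\<dots> \<le> (\<Sum>B\<in>Pow A. norm (\<Sum>n\<in>A. a n *\<^sub>R e n))"
  proof (rule sum_mono)
    fix B
    have "norm (x B) \<le> norm (\<Sum>n\<in>A. a n *\<^sub>R e n)"
      unfolding x_def by (rule norm_sum_mono[OF assms]) simp
    then show "(\<Sum>i<k. \<bar>blinfun_apply (\<phi> i) (x B)\<bar>) \<le> norm (\<Sum>n\<in>A. a n *\<^sub>R e n)"
      using weakly_1_summing_bound[OF \<phi>] order_trans by blast
  qed
  finally show "(\<Sum>i<k. \<bar>FBL_eval (\<Sum>n\<in>A. a n *\<^sub>R lift_basis n) (\<phi> i)\<bar>) \<le> norm (\<Sum>n\<in>A. a n *\<^sub>R e n)"
    using assms by (simp add: f_def card_Pow)
qed

section \<open>The lifting operator\<close>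

definition lifting :: "'a \<Rightarrow> 'a FBL" where
  "lifting x = (\<Sum>n. coord n x *\<^sub>R lift_basis n)"

text \<open>The blocks of this series are dominated in norm by those of the basis expansion of
  \<open>x\<close>.\<close>

lemma lifting_sums: "(\<lambda>n. coord n x *\<^sub>R lift_basis n) sums lifting x"
  unfolding lifting_def
proof (rule summable_sums, unfold summable_Cauchy, intro allI impI)
  fix r :: real assume "r > 0"
  then obtain N where "\<forall>m\<ge>N. \<forall>n. norm (\<Sum>i\<in>{m..<n}. coord i x *\<^sub>R e i) < r"
    using coord_summable[of x] unfolding summable_Cauchy by blast
  then show "\<exists>N. \<forall>m\<ge>N. \<forall>n. norm (\<Sum>i\<in>{m..<n}. coord i x *\<^sub>R lift_basis i) < r"
    using norm_lift_sum_le[of "{_..<_}" "\<lambda>i. coord i x"]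
    by (meson finite_atLeastLessThan le_less_trans)
qed

lemma norm_lifting_le: "norm (lifting x) \<le> norm x"
proof (rule tendsto_upperbound)
  show "(\<lambda>N. norm (\<Sum>n<N. coord n x *\<^sub>R lift_basis n)) \<longlonglongrightarrow> norm (lifting x)"
    using lifting_sums[of x] unfolding sums_def by (rule tendsto_norm)
  show "\<forall>\<^sub>F N in sequentially. norm (\<Sum>n<N. coord n x *\<^sub>R lift_basis n) \<le> norm x"
    using norm_lift_sum_le[of "{..<_}" "\<lambda>i. coord i x"] norm_partial_sum_le[of x]
    by (intro always_eventually allI) (meson finite_lessThan order_trans)
qed simp

text \<open>Disjointness collapses the series: each evaluation of \<open>lifting\<close> is a
  nonnegative multiple of one coordinate, which is why \<open>lifting\<close> preserves the lattice
  operations.\<close>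

lemma eval_lifting:
  "FBL_eval (lifting x) v = coord (active v) x * FBL_eval (lift_basis (active v)) v"
proof (rule sums_unique2)
  show "(\<lambda>n. coord n x * FBL_eval (lift_basis n) v) sums FBL_eval (lifting x) v"
    using bounded_linear.sums[OF FBL_eval_bounded_linear lifting_sums[of x], of v] by simp
  have "(\<lambda>n. coord n x * FBL_eval (lift_basis n) v) =
      (\<lambda>n. if n = active v then coord n x * FBL_eval (lift_basis n) v else 0)"
    by (auto simp: lift_basis_active)
  then show "(\<lambda>n. coord n x * FBL_eval (lift_basis n) v) sums
      (coord (active v) x * FBL_eval (lift_basis (active v)) v)"
    using sums_single[of "active v" "\<lambda>n. coord n x * FBL_eval (lift_basis n) v"] by simp
qed

lemma lattice_hom_lifting: "lattice_hom (coord_le e) (\<le>) lifting"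
proof -
  have "bounded_linear lifting"
    by (rule bounded_linear_intro[of _ 1])
      (auto intro: FBL_eqI simp: eval_lifting norm_lifting_le algebra_simps)
  then show ?thesis
    unfolding lattice_hom_def is_sup_iff is_inf_iff is_sup_coord_iff is_inf_coord_iff
    by (intro conjI allI impI FBL_eqI)
      (simp_all add: eval_lifting lift_basis_nonneg max_mult_distrib_right min_mult_distrib_right)
qed

lemma beta_lifting: "beta (lifting x) = x"
proof (rule coord_eqI)
  fix n
  \<comment> \<open>Otherwise \<open>lift_basis n\<close> would vanish at
    \<open>coord_fun n\<close>, where its value is 1.\<close>
  have "active (coord_fun n) = n"
    using lift_basis_active[of n "coord_fun n"] by (metis lift_basis_coord zero_neq_one)
  then show "coord n (beta (lifting x)) = coord n x"
    by (simp add: eval_lifting lift_basis_coord)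
qed

lemma onorm_lifting: "onorm lifting = 1"
proof (rule antisym)
  show "onorm lifting \<le> 1"
    using norm_lifting_le by (intro onorm_bound) auto
  \<comment> \<open>Since \<open>beta\<close> is a contractive left inverse, \<open>lifting\<close>
    cannot shrink norms; \<open>e 0\<close> serves as a nonzero vector.\<close>
  have "norm (lifting (e 0)) \<ge> norm (e 0)"
    using norm_beta_le[of "lifting (e 0)"] by (simp add: beta_lifting)
  then have "1 * norm (e 0) \<le> onorm lifting * norm (e 0)"
    using onorm[of lifting "e 0"] lattice_hom_lifting by (simp add: lattice_hom_def)
  then show "1 \<le> onorm lifting"
    using basis_nonzero[of 0] by simp
qed

end

theorem theorem4p1:
  fixes e :: "nat \<Rightarrow> 'a::banach"
  assumes "one_unconditional_basis e"
  shows "isometric_lattice_lifting_property (coord_le e)"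
proof -
  interpret unconditional_basis e
    using assms by unfold_locales
  show ?thesis
    unfolding isometric_lattice_lifting_property_def FBL_beta_eq
    using banach_lattice_coord lattice_hom_lifting onorm_lifting
    by (auto simp: fun_eq_iff beta_lifting)
qed

end
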